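(* Let $\varepsilon\in[0,1]$. If all jobs arrive at time $0$, then the algorithm SLF is $(2-\varepsilon)$-competitive for minimizing total flow time in the $\varepsilon$-clairvoyant setting. Moreover, when all jobs arrive at time $0$, every randomized $\varepsilon$-clairvoyant algorithm has competitive ratio at least $2-\varepsilon$.
   Context: Single-machine preemptive scheduling: each job $j$ has a release time $q_j\ge0$ and processing time $p_j>0$; at most one job is processed at any instant (processing several jobs "in parallel at equal pace" means time-sharing with infinitesimally small steps); preemption allowed. $e_j(t)$ is the amount of processing job $j$ received by time $t$, $r_j(t)=p_j-e_j(t)$, $C_j$ the completion time; the objective is total flow time $\sum_j(C_j-q_j)$. In the $\varepsilon$-clairvoyant model, $p_j$ is unknown initially and revealed once $r_j(t)\le\varepsilon p_j$; a job is known if $r_j(t)\le\varepsilon p_j$ and unknown otherwise. Algorithm SLF: for each active job define $\eta_j(t)=\frac{\varepsilon}{1-\varepsilon}e_j(t)$ if unknown and $\eta_j(t)=r_j(t)$ if known; if the minimum estimate over known jobs is at most that over unknown jobs, process a known job of minimum estimate, otherwise process all unknown jobs of minimum estimate in parallel at equal pace. A (randomized) algorithm is $\rho$-competitive if on every instance its (expected) total flow time is at most $\rho$ times the optimum. *)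

theory Defs
  imports "HOL-Probability.Probability"
begin

record scheduling_instance =
  jobs :: "nat set"
  release :: "nat \<Rightarrow> real"
  ptime :: "nat \<Rightarrow> real"

definition valid_instance :: "scheduling_instance \<Rightarrow> bool" where
  "valid_instance I \<longleftrightarrow> finite (jobs I) \<and> (\<forall>j\<in>jobs I. 0 \<le> release I j \<and> 0 < ptime I j)"

definition batch_instances :: "scheduling_instance set" where
  "batch_instances = {I. valid_instance I \<and> (\<forall>j\<in>jobs I. release I j = 0)}"

text \<open>A schedule gives the rate \<open>x j t\<close> at which job \<open>j\<close> is processed at time \<open>t \<ge> 0\<close>.
  Rates strictly between 0 and 1 represent time-sharing with infinitesimally small steps,
  so the single machine becomes the constraint that the rates sum to at most 1.\<close>

type_synonym schedule = "nat \<Rightarrow> real \<Rightarrow> real"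

definition elapsed :: "schedule \<Rightarrow> nat \<Rightarrow> real \<Rightarrow> real" where
  "elapsed x j t = integral {0..t} (x j)"

definition remaining :: "scheduling_instance \<Rightarrow> schedule \<Rightarrow> nat \<Rightarrow> real \<Rightarrow> real" where
  "remaining I x j t = ptime I j - elapsed x j t"

definition feasible :: "scheduling_instance \<Rightarrow> schedule \<Rightarrow> bool" where
  "feasible I x \<longleftrightarrow>
     (\<forall>j. \<forall>t\<ge>0. 0 \<le> x j t \<and> x j integrable_on {0..t}) \<and>
     (\<forall>t\<ge>0. (\<Sum>j\<in>jobs I. x j t) \<le> 1) \<and>
     (\<forall>j. \<forall>t\<ge>0. j \<notin> jobs I \<or> t < release I j \<longrightarrow> x j t = 0) \<and>
     (\<forall>j\<in>jobs I. \<forall>t\<ge>0. elapsed x j t \<le> ptime I j)"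

text \<open>The completion time is \<open>\<infinity>\<close> for a job that never finishes.\<close>

definition completion_time :: "scheduling_instance \<Rightarrow> schedule \<Rightarrow> nat \<Rightarrow> ennreal" where
  "completion_time I x j = (INF t\<in>{t. 0 \<le> t \<and> remaining I x j t \<le> 0}. ennreal t)"

definition total_flow :: "scheduling_instance \<Rightarrow> schedule \<Rightarrow> ennreal" where
  "total_flow I x = (\<Sum>j\<in>jobs I. completion_time I x j - ennreal (release I j))"

definition opt_flow :: "scheduling_instance \<Rightarrow> ennreal" where
  "opt_flow I = (INF x\<in>{x. feasible I x}. total_flow I x)"

definition known :: "real \<Rightarrow> scheduling_instance \<Rightarrow> schedule \<Rightarrow> nat \<Rightarrow> real \<Rightarrow> bool" where
  "known \<epsilon> I x j t \<longleftrightarrow> remaining I x j t \<le> \<epsilon> * ptime I j"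

text \<open>What an \<open>\<epsilon>\<close>-clairvoyant scheduler sees of job \<open>j\<close> at time \<open>t\<close>: nothing before the release
  (\<open>None\<close>), then its existence (\<open>Some None\<close>), then its processing time (\<open>Some (Some p)\<close>).\<close>

definition observation ::
  "real \<Rightarrow> scheduling_instance \<Rightarrow> schedule \<Rightarrow> real \<Rightarrow> nat \<Rightarrow> real option option" where
  "observation \<epsilon> I x t j =
     (if j \<in> jobs I \<and> release I j \<le> t
      then Some (if known \<epsilon> I x j t then Some (ptime I j) else None)
      else None)"

type_synonym algorithm = "scheduling_instance \<Rightarrow> schedule"

text \<open>Non-anticipation: as long as two instances have produced the same observations, the
  algorithm has treated them identically. Elapsed times are continuous and an unknown job
  has received strictly less than \<open>(1 - \<epsilon>) p\<close>, so equal observations at a time persist for a short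
  while; hence the two runs can only diverge after a genuinely different revelation.\<close>

definition eps_clairvoyant :: "scheduling_instance set \<Rightarrow> real \<Rightarrow> algorithm \<Rightarrow> bool" where
  "eps_clairvoyant \<I> \<epsilon> A \<longleftrightarrow>
     (\<forall>I\<in>\<I>. feasible I (A I)) \<and>
     (\<forall>I\<in>\<I>. \<forall>I'\<in>\<I>. \<forall>t\<ge>0.
        (\<forall>s\<in>{0..t}. observation \<epsilon> I (A I) s = observation \<epsilon> I' (A I') s) \<longrightarrow>
        (\<forall>s\<in>{0..t}. \<forall>j. elapsed (A I) j s = elapsed (A I') j s))"

definition competitive :: "scheduling_instance set \<Rightarrow> real \<Rightarrow> algorithm \<Rightarrow> bool" where
  "competitive \<I> \<rho> A \<longleftrightarrow> (\<forall>I\<in>\<I>. total_flow I (A I) \<le> ennreal \<rho> * opt_flow I)"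

text \<open>A randomized algorithm is a random deterministic algorithm: \<open>\<omega>\<close> is the random seed.\<close>

definition randomized_eps_clairvoyant ::
  "scheduling_instance set \<Rightarrow> real \<Rightarrow> 'w measure \<Rightarrow> ('w \<Rightarrow> algorithm) \<Rightarrow> bool" where
  "randomized_eps_clairvoyant \<I> \<epsilon> M A \<longleftrightarrow>
     prob_space M \<and>
     (\<forall>\<omega>\<in>space M. eps_clairvoyant \<I> \<epsilon> (A \<omega>)) \<and>
     (\<forall>I\<in>\<I>. (\<lambda>\<omega>. total_flow I (A \<omega> I)) \<in> borel_measurable M)"

definition randomized_competitive ::
  "scheduling_instance set \<Rightarrow> real \<Rightarrow> 'w measure \<Rightarrow> ('w \<Rightarrow> algorithm) \<Rightarrow> bool" where
  "randomized_competitive \<I> \<rho> M A \<longleftrightarrow>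
     (\<forall>I\<in>\<I>. (\<integral>\<^sup>+\<omega>. total_flow I (A \<omega> I) \<partial>M) \<le> ennreal \<rho> * opt_flow I)"

definition active_jobs :: "scheduling_instance \<Rightarrow> schedule \<Rightarrow> real \<Rightarrow> nat set" where
  "active_jobs I x t = {j\<in>jobs I. release I j \<le> t \<and> 0 < remaining I x j t}"

text \<open>For \<open>\<epsilon> = 1\<close> every job is known, so the totalised division by 0 is never used.\<close>

definition estimate :: "real \<Rightarrow> scheduling_instance \<Rightarrow> schedule \<Rightarrow> real \<Rightarrow> nat \<Rightarrow> real" where
  "estimate \<epsilon> I x t j =
     (if known \<epsilon> I x j t then remaining I x j t else \<epsilon> / (1 - \<epsilon>) * elapsed x j t)"

text \<open>The choice among known jobs of equal minimum estimate is left open.\<close>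

definition SLF_rule :: "real \<Rightarrow> scheduling_instance \<Rightarrow> schedule \<Rightarrow> real \<Rightarrow> bool" where
  "SLF_rule \<epsilon> I x t \<longleftrightarrow>
     (let K = {j\<in>active_jobs I x t. known \<epsilon> I x j t};
          U = {j\<in>active_jobs I x t. \<not> known \<epsilon> I x j t};
          \<eta> = estimate \<epsilon> I x t
      in if K \<noteq> {} \<and> (U = {} \<or> Min (\<eta> ` K) \<le> Min (\<eta> ` U))
         then \<exists>j\<in>K. \<eta> j = Min (\<eta> ` K) \<and> (\<forall>k\<in>jobs I. x k t = (if k = j then 1 else 0))
         else let L = {j\<in>U. \<eta> j = Min (\<eta> ` U)}
              in \<forall>k\<in>jobs I. x k t = (if k \<in> L then 1 / real (card L) else 0))"

definition SLF_schedule :: "real \<Rightarrow> scheduling_instance \<Rightarrow> schedule \<Rightarrow> bool" where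
  "SLF_schedule \<epsilon> I x \<longleftrightarrow> feasible I x \<and> (\<forall>t\<ge>0. SLF_rule \<epsilon> I x t)"

definition is_SLF :: "scheduling_instance set \<Rightarrow> real \<Rightarrow> algorithm \<Rightarrow> bool" where
  "is_SLF \<I> \<epsilon> A \<longleftrightarrow> (\<forall>I\<in>\<I>. SLF_schedule \<epsilon> I (A I))"

end

theory Submission
  imports Defs
begin

text \<open>Write \<open>e\<^sub>i(t)\<close> for the processing received by job \<open>i\<close> up to time \<open>t\<close>. A schedule that never idles
  has \<open>C\<^sub>j = (\<Sum>i. e\<^sub>i(C\<^sub>j))\<close>, and any schedule has \<open>\<ge>\<close>. So the total flow time is governed by the
  sums \<open>e\<^sub>i(C\<^sub>j) + e\<^sub>j(C\<^sub>i)\<close> over unordered pairs. Such a sum is at least the processing that the pair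
  has received when its first job completes, hence at least \<open>min p\<^sub>i p\<^sub>j\<close>, which bounds the optimum
  from below.

  Under SLF all unknown jobs are level, and a job that becomes known is completed before any longer
  job proceeds. Hence the sum is at most \<open>(2 - \<epsilon>) min p\<^sub>i p\<^sub>j\<close>. For \<open>\<epsilon> = 1\<close> this also shows that
  the lower bound on the optimum is attained.

  For the lower bound let the lengths be independent truncated geometric variables. While both jobs of
  a pair are unknown, memorylessness makes the chance that neither becomes known within \<open>(1 - \<epsilon>) k\<close>
  units of processing of the pair at least \<open>r ^ k\<close>, whatever the algorithm does. So the pair consumes
  in expectation about \<open>2 (1 - \<epsilon>) E[min p\<^sub>i p\<^sub>j]\<close> before either job is known, and afterwards at least
  \<open>\<epsilon> min p\<^sub>i p\<^sub>j\<close> until the first completion. A finitely supported distribution is used, so that no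
  joint measurability in the seed and the instance is required.\<close>

section \<open>Feasible schedules\<close>

text \<open>The set where f \<le> c is compact, and s is its maximum. If f s were below c, the
  intermediate value theorem would give a later point of the set. The arguments by contradiction
  below start from the last moment before a forbidden inequality, which then holds strictly ever
  after.\<close>

lemma last_time_below:
  fixes f :: "real \<Rightarrow> real"
  assumes "continuous_on {a..b} f" "a \<le> b" "f a \<le> c" "c < f b"
  obtains s where "a \<le> s" "s < b" "f s = c" "\<And>u. s < u \<Longrightarrow> u \<le> b \<Longrightarrow> c < f u"
proof -
  let ?S = "{u \<in> {a..b}. f u \<le> c}"
  have "closed ?S"
    using continuous_closed_preimage[OF assms(1), of "{..c}"] by (simp add: vimage_def Int_def)
  then have "compact ?S"
    by (metis (no_types, lifting) bounded_closed_interval bounded_subset compact_eq_bounded_closed mem_Collect_eq subsetI)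
  moreover have "?S \<noteq> {}" using assms by auto
  ultimately obtain s where s: "s \<in> ?S" "\<And>u. u \<in> ?S \<Longrightarrow> u \<le> s"
    using compact_attains_sup[of ?S] by blast
  have above: "c < f u" if "s < u" "u \<le> b" for u
    using s(1) s(2)[of u] that by force
  have "s < b" using s assms(4) by (metis (no_types, lifting) atLeastAtMost_iff leD le_less mem_Collect_eq)
  have "f s = c"
  proof (rule ccontr)
    assume "f s \<noteq> c"
    with s have "f s < c" by auto
    moreover have "continuous_on {s..b} f"
      using assms(1) by (rule continuous_on_subset) (use s in auto)
    ultimately obtain u where "s \<le> u" "u \<le> b" "f u = c"
      using IVT'[of f s c b] assms(4) \<open>s < b\<close> by auto
    with above[of u] \<open>f s < c\<close> show False by (cases "s = u") auto
  qed
  with above s \<open>s < b\<close> show thesis by (intro that[of s]) auto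
qed

text \<open>This is \<open>last_time_below\<close> for u \<mapsto> - f (- u) on the reflected
  interval.\<close>

lemma first_time_reaching:
  fixes f :: "real \<Rightarrow> real"
  assumes "continuous_on {a..b} f" "a \<le> b" "f a < c" "c \<le> f b"
  obtains s where "a < s" "s \<le> b" "f s = c" "\<And>u. a \<le> u \<Longrightarrow> u < s \<Longrightarrow> f u < c"
proof -
  have "continuous_on {-b..-a} (\<lambda>u. - f (- u))"
    by (intro continuous_intros continuous_on_compose2[OF assms(1)]) auto
  then obtain s where "-b \<le> s" "s < -a" "- f (-s) = - c" "\<And>u. s < u \<Longrightarrow> u \<le> -a \<Longrightarrow> - c < - f (-u)"
    using last_time_below[of "-b" "-a" "\<lambda>u. - f (- u)" "-c"] assms by auto
  from this(1-3) this(4)[of "- _"] show thesis by (intro that[of "-s"]) auto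
qed

text \<open>Facts about a run hold while a job is active, that is strictly before a completion;
  continuity carries them to the completion itself.\<close>

lemma le_at_right_end:
  fixes f :: "real \<Rightarrow> real"
  assumes "continuous_on {0..b} f" "0 < b" "\<And>u. 0 \<le> u \<Longrightarrow> u < b \<Longrightarrow> f u \<le> c"
  shows "f b \<le> c"
proof (rule ccontr)
  assume "\<not> f b \<le> c"
  then obtain s where "0 \<le> s" "s < b" "\<And>u. s < u \<Longrightarrow> u \<le> b \<Longrightarrow> c < f u"
    using last_time_below[OF assms(1), of c] assms(2) assms(3)[of 0] by (metis linorder_not_le less_imp_le order_refl)
  from this(1,2) this(3)[of "(s+b)/2"] assms(3)[of "(s+b)/2"] show False by auto
qed

text \<open>Only gauge integrability of f is given, so integrability of its absolute value is part
  of the claim. By additivity all integrals over subintervals vanish. Henstock's lemma then bounds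
  the Riemann sums of the absolute value, because the integrals it subtracts are zero.\<close>

lemma zero_indefinite_integral_imp_abs:
  fixes f :: "real \<Rightarrow> real"
  assumes int: "f integrable_on {a..b}" and zero: "\<And>u. u \<in> {a..b} \<Longrightarrow> integral {a..u} f = 0"
  shows "((\<lambda>u. \<bar>f u\<bar>) has_integral 0) {a..b}"
proof -
  have sub: "integral {u..v} f = 0" if "a \<le> u" "v \<le> b" for u v
  proof (cases "u \<le> v")
    case True
    have "integral {a..u} f + integral {u..v} f = integral {a..v} f"
      by (rule Henstock_Kurzweil_Integration.integral_combine)
        (use that True in \<open>auto intro: integrable_on_subinterval[OF int]\<close>)
    with zero[of u] zero[of v] that True show ?thesis by auto
  qed auto
  have "((\<lambda>u. \<bar>f u\<bar>) has_integral 0) (cbox a b)"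
    unfolding has_integral
  proof (intro allI impI)
    fix e :: real assume "e > 0"
    obtain \<gamma> where \<gamma>: "gauge \<gamma>" "\<And>p. \<lbrakk>p tagged_partial_division_of (cbox a b); \<gamma> fine p\<rbrakk> \<Longrightarrow>
             sum (\<lambda>(x,k). norm(measure lborel k *\<^sub>R f x - integral k f)) p < e"
      using Henstock_lemma[of f a b e] int \<open>e > 0\<close> by auto
    have "norm ((\<Sum>(x, k)\<in>p. measure lborel k *\<^sub>R \<bar>f x\<bar>) - 0) < e"
      if p: "p tagged_division_of cbox a b" "\<gamma> fine p" for p
    proof -
      have "(\<Sum>(x, k)\<in>p. measure lborel k *\<^sub>R \<bar>f x\<bar>) = (\<Sum>(x,k)\<in>p. norm(measure lborel k *\<^sub>R f x - integral k f))"
      proof (rule sum.cong[OF refl], clarify)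
        fix u k assume "(u,k) \<in> p"
        with p(1) obtain v w where k: "k = cbox v w" "k \<subseteq> cbox a b" "u \<in> k"
          by (meson tagged_division_ofD(2,3,4))
        then have "integral k f = 0" using sub[of v w] by auto
        then show "measure lborel k *\<^sub>R \<bar>f u\<bar> = norm (measure lborel k *\<^sub>R f u - integral k f)"
          by (simp add: abs_mult)
      qed
      moreover have "\<dots> < e" using \<gamma>(2) p tagged_division_of_def by blast
      moreover have "0 \<le> (\<Sum>(x, k)\<in>p. measure lborel k *\<^sub>R \<bar>f x\<bar>)"
        by (intro sum_nonneg) auto
      ultimately show ?thesis by simp
    qed
    then show "\<exists>\<gamma>. gauge \<gamma> \<and> (\<forall>\<D>. \<D> tagged_division_of cbox a b \<and> \<gamma> fine \<D> \<longrightarrow>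
             norm ((\<Sum>(x, k)\<in>\<D>. measure lborel k *\<^sub>R \<bar>f x\<bar>) - 0) < e)"
      by (intro exI[of _ \<gamma>] conjI allI impI \<gamma>(1)) (elim conjE)
  qed
  then show ?thesis by simp
qed

section \<open>Elapsed processing in a feasible schedule\<close>

lemma feasible_integrable:
  assumes "feasible I x" "0 \<le> s"
  shows "x j integrable_on {s..t}"
proof (cases "s \<le> t")
  case True
  then have "x j integrable_on {0..t}" using assms by (auto simp: feasible_def)
  then show ?thesis by (rule integrable_on_subinterval) (use assms in auto)
qed auto

lemma feasible_nonneg: "feasible I x \<Longrightarrow> 0 \<le> t \<Longrightarrow> 0 \<le> x j t"
  by (auto simp: feasible_def)

lemma feasible_le_ptime: "feasible I x \<Longrightarrow> j \<in> jobs I \<Longrightarrow> 0 \<le> t \<Longrightarrow> elapsed x j t \<le> ptime I j"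
  by (auto simp: feasible_def)

lemma elapsed_split:
  assumes "feasible I x" "0 \<le> s" "s \<le> t"
  shows "elapsed x j t = elapsed x j s + integral {s..t} (x j)"
  unfolding elapsed_def using assms
  by (intro Henstock_Kurzweil_Integration.integral_combine[symmetric] feasible_integrable) auto

lemma elapsed_0 [simp]: "elapsed x j 0 = 0"
  by (simp add: elapsed_def)

lemma elapsed_mono:
  assumes "feasible I x" "0 \<le> s" "s \<le> t"
  shows "elapsed x j s \<le> elapsed x j t"
  using elapsed_split[OF assms] integral_nonneg[OF feasible_integrable[OF assms(1,2)], of t j]
    feasible_nonneg[OF assms(1)] assms by auto

lemma elapsed_nonneg: "feasible I x \<Longrightarrow> 0 \<le> t \<Longrightarrow> 0 \<le> elapsed x j t"
  using elapsed_mono[of I x 0 t j] by simp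

lemma elapsed_continuous: "feasible I x \<Longrightarrow> 0 \<le> s \<Longrightarrow> continuous_on {s..t} (elapsed x j)"
proof -
  assume *: "feasible I x" "0 \<le> s"
  have "continuous_on {0..t} (elapsed x j)"
    unfolding elapsed_def using * by (intro indefinite_integral_continuous_1 feasible_integrable) auto
  then show ?thesis by (rule continuous_on_subset) (use * in auto)
qed

lemma elapsed_increment_le:
  assumes "feasible I x" "0 \<le> s" "s \<le> t" "\<And>u. s < u \<Longrightarrow> u \<le> t \<Longrightarrow> x j u \<le> x i u"
  shows "elapsed x j t - elapsed x j s \<le> elapsed x i t - elapsed x i s"
proof -
  have "integral {s..t} (x j) \<le> integral {s..t} (x i)"
  proof (cases "s = t")
    case False
    \<comment> \<open>The rates are compared on (s, t] only; resetting them at s makes the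
      comparison total and leaves the integrals unchanged.\<close>
    let ?f = "\<lambda>k u. if u = s then 0 else x k u"
    have eq: "integral {s..t} (?f k) = integral {s..t} (x k)" for k
      by (rule integral_spike[of "{s}"]) auto
    have int: "?f k integrable_on {s..t}" for k
      by (rule integrable_spike[OF feasible_integrable[OF assms(1,2), of k t], of "{s}"]) auto
    have "integral {s..t} (?f j) \<le> integral {s..t} (?f i)"
      by (rule integral_le[OF int int]) (use assms in auto)
    then show ?thesis by (simp add: eq)
  qed auto
  then show ?thesis using elapsed_split[OF assms(1-3)] by simp
qed

lemma elapsed_const:
  assumes "feasible I x" "0 \<le> s" "s \<le> t" "\<And>u. s < u \<Longrightarrow> u \<le> t \<Longrightarrow> x j u = 0"
  shows "elapsed x j t = elapsed x j s"
proof -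
  have "integral {s..t} (x j) = integral {s..t} (\<lambda>_. 0)"
    by (rule integral_spike[of "{s}"]) (use assms in auto)
  then show ?thesis using elapsed_split[OF assms(1-3), of j] by simp
qed

lemma sum_elapsed:
  assumes "feasible I x" "finite (jobs I)" "0 \<le> t"
  shows "(\<Sum>i\<in>jobs I. elapsed x i t) = integral {0..t} (\<lambda>u. \<Sum>i\<in>jobs I. x i u)"
  unfolding elapsed_def using assms by (intro integral_sum[symmetric] feasible_integrable) auto

lemma sum_elapsed_le:
  assumes "feasible I x" "finite (jobs I)" "0 \<le> t"
  shows "(\<Sum>i\<in>jobs I. elapsed x i t) \<le> t"
proof -
  have "integral {0..t} (\<lambda>u. \<Sum>i\<in>jobs I. x i u) \<le> integral {0..t} (\<lambda>u. 1::real)"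
    using assms
    by (intro integral_le integrable_sum feasible_integrable[OF assms(1)])
       (auto simp: feasible_def intro: integrable_on_const)
  then show ?thesis using sum_elapsed[OF assms] assms by simp
qed

section \<open>Completion times and total flow of batch instances\<close>

text \<open>A real witness for the infimum in \<open>completion_time\<close>, which lives in
  \<open>ennreal\<close>; the clause on earlier times forces it to be that infimum.\<close>

definition completes_at :: "scheduling_instance \<Rightarrow> schedule \<Rightarrow> nat \<Rightarrow> real \<Rightarrow> bool" where
  "completes_at I x j c \<longleftrightarrow> 0 \<le> c \<and> elapsed x j c = ptime I j \<and>
     (\<forall>t. 0 \<le> t \<and> t < c \<longrightarrow> elapsed x j t < ptime I j)"

lemma completion_time_eq:
  assumes "completes_at I x j c"
  shows "completion_time I x j = ennreal c"
  unfolding completion_time_def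
proof (rule antisym)
  show "(INF t\<in>{t. 0 \<le> t \<and> remaining I x j t \<le> 0}. ennreal t) \<le> ennreal c"
    using assms by (intro INF_lower) (auto simp: completes_at_def remaining_def)
  show "ennreal c \<le> (INF t\<in>{t. 0 \<le> t \<and> remaining I x j t \<le> 0}. ennreal t)"
    using assms by (intro INF_greatest ennreal_leI) (force simp: completes_at_def remaining_def)
qed

lemma completes_atI:
  assumes "feasible I x" "j \<in> jobs I" "0 < ptime I j" "0 \<le> t" "ptime I j \<le> elapsed x j t"
  obtains c where "completes_at I x j c" "0 < c" "c \<le> t"
proof -
  obtain c where "0 < c" "c \<le> t" "elapsed x j c = ptime I j" "\<And>u. 0 \<le> u \<Longrightarrow> u < c \<Longrightarrow> elapsed x j u < ptime I j"
    using first_time_reaching[OF elapsed_continuous[OF assms(1) order_refl, of t j], of "ptime I j"] assms by auto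
  then show thesis by (intro that[of c]) (auto simp: completes_at_def)
qed

lemma finite_completion_timeE:
  assumes "feasible I x" "j \<in> jobs I" "0 < ptime I j" "completion_time I x j \<noteq> \<infinity>"
  obtains c where "completes_at I x j c" "0 < c"
proof -
  \<comment> \<open>The infimum of the empty set in \<open>ennreal\<close> is \<infinity>.\<close>
  have "{t. 0 \<le> t \<and> remaining I x j t \<le> 0} \<noteq> {}"
    using assms(4) unfolding completion_time_def by (metis Inf_empty image_empty infinity_ennreal_def)
  then obtain t where "0 \<le> t" "ptime I j \<le> elapsed x j t" by (auto simp: remaining_def)
  with completes_atI[OF assms(1-3)] that show thesis by metis
qed

lemma batch_finite: "I \<in> batch_instances \<Longrightarrow> finite (jobs I)"
  by (auto simp: batch_instances_def valid_instance_def)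

lemma batch_ptime_pos: "I \<in> batch_instances \<Longrightarrow> j \<in> jobs I \<Longrightarrow> 0 < ptime I j"
  by (auto simp: batch_instances_def valid_instance_def)

lemma batch_release: "I \<in> batch_instances \<Longrightarrow> j \<in> jobs I \<Longrightarrow> release I j = 0"
  by (auto simp: batch_instances_def)

lemma total_flow_eq:
  assumes "I \<in> batch_instances" "\<And>j. j \<in> jobs I \<Longrightarrow> completes_at I x j (c j)"
  shows "total_flow I x = ennreal (\<Sum>j\<in>jobs I. c j)"
proof -
  have "total_flow I x = (\<Sum>j\<in>jobs I. ennreal (c j))"
    unfolding total_flow_def using assms batch_release[OF assms(1)]
    by (intro sum.cong) (auto simp: completion_time_eq)
  also have "\<dots> = ennreal (\<Sum>j\<in>jobs I. c j)"
    using assms(2) by (intro sum_ennreal) (auto simp: completes_at_def)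
  finally show ?thesis .
qed

lemma total_flow_finiteE:
  assumes "I \<in> batch_instances" "feasible I x" "total_flow I x \<noteq> \<infinity>"
  obtains c where "\<And>j. j \<in> jobs I \<Longrightarrow> completes_at I x j (c j)" "total_flow I x = ennreal (\<Sum>j\<in>jobs I. c j)"
proof -
  have "\<exists>c. completes_at I x j c" if j: "j \<in> jobs I" for j
  proof -
    have "completion_time I x j - ennreal (release I j) \<noteq> \<infinity>"
      using assms(3) j batch_finite[OF assms(1)] unfolding total_flow_def by auto
    then have "completion_time I x j \<noteq> \<infinity>" using batch_release[OF assms(1) j] by simp
    then show ?thesis
      using finite_completion_timeE[OF assms(2) j batch_ptime_pos[OF assms(1) j]] by metis
  qed
  then obtain c where "\<And>j. j \<in> jobs I \<Longrightarrow> completes_at I x j (c j)" by metis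
  with total_flow_eq[OF assms(1) this] that show thesis by blast
qed

section \<open>Pairwise accounting and the lower bound on the optimum\<close>

lemma sum_symmetrize:
  fixes f :: "'a \<Rightarrow> 'a \<Rightarrow> real"
  shows "2 * (\<Sum>j\<in>J. \<Sum>i\<in>J. f i j) = (\<Sum>i\<in>J. \<Sum>j\<in>J. f i j + f j i)"
  by (simp add: sum.distrib sum.swap[of f J J])

lemma pairwise_le_twice_completion:
  assumes "I \<in> batch_instances" "feasible I x" "\<And>j. j \<in> jobs I \<Longrightarrow> completes_at I x j (c j)"
  shows "(\<Sum>i\<in>jobs I. \<Sum>j\<in>jobs I. elapsed x i (c j) + elapsed x j (c i)) \<le> 2 * (\<Sum>j\<in>jobs I. c j)"
proof -
  have "(\<Sum>j\<in>jobs I. \<Sum>i\<in>jobs I. elapsed x i (c j)) \<le> (\<Sum>j\<in>jobs I. c j)"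
    using assms batch_finite by (intro sum_mono sum_elapsed_le) (auto simp: completes_at_def)
  then show ?thesis by (simp flip: sum_symmetrize)
qed

text \<open>If i completes first, at c \<le> d, the term e_j(c) occurs on both sides and e_i(c)
  \<le> e_i(d) by monotonicity. The other case is symmetric.\<close>

lemma pairwise_ge_at_first_completion:
  assumes "feasible I x" "completes_at I x i c" "completes_at I x j d"
  shows "elapsed x i (min c d) + elapsed x j (min c d) \<le> elapsed x i d + elapsed x j c"
  using assms elapsed_mono[OF assms(1), of c d i] elapsed_mono[OF assms(1), of d c j]
  by (auto simp: completes_at_def min_def)

lemma pairwise_ge_min:
  assumes "feasible I x" "completes_at I x i c" "completes_at I x j d"
  shows "min (ptime I i) (ptime I j) \<le> elapsed x i d + elapsed x j c"
proof -
  have "min (ptime I i) (ptime I j) \<le> elapsed x i (min c d) + elapsed x j (min c d)"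
    using assms elapsed_nonneg[OF assms(1), of c j] elapsed_nonneg[OF assms(1), of d i]
    by (auto simp: completes_at_def min_def)
  also have "\<dots> \<le> elapsed x i d + elapsed x j c"
    by (rule pairwise_ge_at_first_completion[OF assms])
  finally show ?thesis .
qed

text \<open>Ordered pairs are summed, so the factor \<kappa> / 2 charges \<kappa> times the smaller
  length to each unordered pair. For \<kappa> = 1 this is the optimum of a batch instance, by
  \<open>opt_flow_ge\<close> and \<open>opt_flow_le\<close>; for \<kappa> = 2 - \<epsilon> it bounds
  SLF.\<close>

definition pair_bound :: "real \<Rightarrow> scheduling_instance \<Rightarrow> real" where
  "pair_bound \<kappa> I = (\<Sum>i\<in>jobs I. \<Sum>j\<in>jobs I.
     if i = j then ptime I i else \<kappa> / 2 * min (ptime I i) (ptime I j))"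

lemma pair_bound_nonneg: "I \<in> batch_instances \<Longrightarrow> 0 \<le> \<kappa> \<Longrightarrow> 0 \<le> pair_bound \<kappa> I"
  unfolding pair_bound_def using batch_ptime_pos[of I]
  by (intro sum_nonneg) (auto simp: less_imp_le min_def)

lemma pair_bound_le:
  assumes "I \<in> batch_instances" "1 \<le> \<kappa>"
  shows "pair_bound \<kappa> I \<le> \<kappa> * pair_bound 1 I"
  unfolding pair_bound_def sum_distrib_left using assms batch_ptime_pos[OF assms(1)]
  by (intro sum_mono) (auto simp: less_imp_le)

lemma opt_flow_ge:
  assumes "I \<in> batch_instances"
  shows "ennreal (pair_bound 1 I) \<le> opt_flow I"
  unfolding opt_flow_def
proof (rule INF_greatest, clarify)
  fix x assume x: "feasible I x"
  show "ennreal (pair_bound 1 I) \<le> total_flow I x"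
  proof (cases "total_flow I x = \<infinity>")
    case False
    obtain c where c: "\<And>j. j \<in> jobs I \<Longrightarrow> completes_at I x j (c j)"
      and flow: "total_flow I x = ennreal (\<Sum>j\<in>jobs I. c j)"
      using total_flow_finiteE[OF assms x False] by metis
    have "2 * pair_bound 1 I \<le> (\<Sum>i\<in>jobs I. \<Sum>j\<in>jobs I. elapsed x i (c j) + elapsed x j (c i))"
      unfolding pair_bound_def sum_distrib_left
    proof (intro sum_mono)
      fix i j assume ij: "i \<in> jobs I" "j \<in> jobs I"
      have "min (ptime I i) (ptime I j) \<le> elapsed x i (c j) + elapsed x j (c i)"
        by (rule pairwise_ge_min[OF x c c]) (use ij in auto)
      \<comment> \<open>On the diagonal the pair sum is exactly twice the length.\<close>
      then show "2 * (if i = j then ptime I i else 1 / 2 * min (ptime I i) (ptime I j))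
          \<le> elapsed x i (c j) + elapsed x j (c i)"
        using c[OF ij(1)] by (auto simp: completes_at_def)
    qed
    with pairwise_le_twice_completion[OF assms x c] show ?thesis
      unfolding flow by (intro ennreal_leI) simp
  qed simp
qed

section \<open>The SLF rule is \<open>(2 - \<epsilon>)\<close>-competitive\<close>

text \<open>Removes the nested minima: in either branch the processed jobs minimise the estimate
  over all active jobs, known or not. The tie clause of \<open>parallel\<close> says that no unknown
  job at the minimum is left out, which is what keeps unknown jobs level.\<close>

lemma SLF_rule_cases:
  assumes rule: "SLF_rule \<epsilon> I x t" and fin: "finite (jobs I)" and ne: "active_jobs I x t \<noteq> {}"
  obtains
    (single) j where "j \<in> active_jobs I x t" "known \<epsilon> I x j t"
      "\<And>i. i \<in> active_jobs I x t \<Longrightarrow> estimate \<epsilon> I x t j \<le> estimate \<epsilon> I x t i"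
      "\<And>k. k \<in> jobs I \<Longrightarrow> x k t = (if k = j then 1 else 0)"
  | (parallel) L where "L \<noteq> {}" "L \<subseteq> active_jobs I x t"
      "\<And>j. j \<in> L \<Longrightarrow> \<not> known \<epsilon> I x j t"
      "\<And>i j. j \<in> L \<Longrightarrow> i \<in> active_jobs I x t \<Longrightarrow> estimate \<epsilon> I x t j \<le> estimate \<epsilon> I x t i"
      "\<And>i j. j \<in> L \<Longrightarrow> i \<in> active_jobs I x t \<Longrightarrow> \<not> known \<epsilon> I x i t \<Longrightarrow>
         estimate \<epsilon> I x t i = estimate \<epsilon> I x t j \<Longrightarrow> i \<in> L"
      "\<And>k. k \<in> jobs I \<Longrightarrow> x k t = (if k \<in> L then 1 / real (card L) else 0)"
proof -
  let ?A = "active_jobs I x t"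
  let ?\<eta> = "estimate \<epsilon> I x t"
  define K where "K = {j\<in>?A. known \<epsilon> I x j t}"
  define U where "U = {j\<in>?A. \<not> known \<epsilon> I x j t}"
  have KU: "?A = K \<union> U" by (auto simp: K_def U_def)
  have "finite ?A" using fin by (auto simp: active_jobs_def)
  then have finK: "finite (?\<eta> ` K)" and finU: "finite (?\<eta> ` U)" by (auto simp: K_def U_def)
  show thesis
  proof (cases "K \<noteq> {} \<and> (U = {} \<or> Min (?\<eta> ` K) \<le> Min (?\<eta> ` U))")
    case True
    with rule obtain j where j: "j \<in> K" "?\<eta> j = Min (?\<eta> ` K)" "\<forall>k\<in>jobs I. x k t = (if k = j then 1 else 0)"
      unfolding SLF_rule_def Let_def K_def[symmetric] U_def[symmetric] by auto
    have "?\<eta> j \<le> ?\<eta> i" if "i \<in> ?A" for i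
    proof (cases "i \<in> K")
      case True then show ?thesis using j finK by auto
    next
      case False
      with that have "i \<in> U" by (auto simp: KU)
      with finU have "Min (?\<eta> ` U) \<le> ?\<eta> i" by auto
      moreover have "Min (?\<eta> ` K) \<le> Min (?\<eta> ` U)" using True \<open>i \<in> U\<close> by auto
      ultimately show ?thesis using j by linarith
    qed
    with j show thesis by (intro single[of j]) (auto simp: K_def)
  next
    case False
    with KU ne have "U \<noteq> {}" by auto
    define L where "L = {j\<in>U. ?\<eta> j = Min (?\<eta> ` U)}"
    have x: "\<forall>k\<in>jobs I. x k t = (if k \<in> L then 1 / real (card L) else 0)"
      using False rule unfolding SLF_rule_def Let_def K_def[symmetric] U_def[symmetric] L_def by auto
    have "Min (?\<eta> ` U) \<in> ?\<eta> ` U" using finU \<open>U \<noteq> {}\<close> by (intro Min_in) auto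
    then have "L \<noteq> {}" by (auto simp: L_def)
    moreover have "?\<eta> j \<le> ?\<eta> i" if "j \<in> L" "i \<in> ?A" for i j
    proof (cases "i \<in> U")
      case True then show ?thesis using that finU by (auto simp: L_def)
    next
      case False' : False
      with that have "i \<in> K" by (auto simp: KU)
      with finK have "Min (?\<eta> ` K) \<le> ?\<eta> i" by auto
      moreover have "Min (?\<eta> ` U) < Min (?\<eta> ` K)" using False \<open>i \<in> K\<close> by auto
      ultimately show ?thesis using that by (auto simp: L_def)
    qed
    moreover have "L \<subseteq> ?A" "\<And>j. j \<in> L \<Longrightarrow> \<not> known \<epsilon> I x j t" by (auto simp: L_def U_def)
    moreover have "i \<in> L" if "j \<in> L" "i \<in> ?A" "\<not> known \<epsilon> I x i t" "?\<eta> i = ?\<eta> j" for i j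
      using that by (auto simp: L_def U_def)
    ultimately show thesis using x by (intro parallel[of L]) (assumption | blast)+
  qed
qed

lemma SLF_rule_idle:
  assumes "SLF_rule \<epsilon> I x t" "active_jobs I x t = {}" "k \<in> jobs I"
  shows "x k t = 0"
  using assms by (auto simp: SLF_rule_def Let_def)

section \<open>Behaviour of an arbitrary SLF run on a batch instance\<close>

locale slf_run =
  fixes \<epsilon> :: real and I :: scheduling_instance and x :: schedule
  assumes eps: "0 \<le> \<epsilon>" "\<epsilon> \<le> 1" and batch: "I \<in> batch_instances" and slf: "SLF_schedule \<epsilon> I x"
begin

abbreviation "J \<equiv> jobs I"
abbreviation "p \<equiv> ptime I"
abbreviation "e \<equiv> elapsed x"
abbreviation "\<eta> \<equiv> estimate \<epsilon> I x"

lemma feas: "feasible I x" and rule: "0 \<le> t \<Longrightarrow> SLF_rule \<epsilon> I x t"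
  using slf by (auto simp: SLF_schedule_def)

lemmas fin = batch_finite[OF batch] and ppos = batch_ptime_pos[OF batch]
lemmas e_mono = elapsed_mono[OF feas] and e_nonneg = elapsed_nonneg[OF feas]
  and e_le = feasible_le_ptime[OF feas] and e_cont = elapsed_continuous[OF feas]
  and x_nonneg = feasible_nonneg[OF feas]

lemma active_iff: "0 \<le> t \<Longrightarrow> j \<in> active_jobs I x t \<longleftrightarrow> j \<in> J \<and> e j t < p j"
  using batch_release[OF batch] by (auto simp: active_jobs_def remaining_def)

lemma known_iff: "known \<epsilon> I x j t \<longleftrightarrow> (1 - \<epsilon>) * p j \<le> e j t"
  by (auto simp: known_def remaining_def algebra_simps)

lemma estimate_known: "(1 - \<epsilon>) * p j \<le> e j t \<Longrightarrow> \<eta> t j = p j - e j t"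
  by (simp add: estimate_def known_iff remaining_def)

lemma estimate_unknown: "e j t < (1 - \<epsilon>) * p j \<Longrightarrow> \<eta> t j = \<epsilon> / (1 - \<epsilon>) * e j t"
  by (simp add: estimate_def known_iff)

lemma unknown_active: "j \<in> J \<Longrightarrow> e j t < (1 - \<epsilon>) * p j \<Longrightarrow> e j t < p j"
  using ppos[of j] eps by (smt (verit) mult_left_le_one_le)

lemma processed_minimal:
  assumes "0 \<le> t" "j \<in> J" "x j t \<noteq> 0"
  shows "e j t < p j" "i \<in> J \<Longrightarrow> e i t < p i \<Longrightarrow> \<eta> t j \<le> \<eta> t i"
proof -
  have ne: "active_jobs I x t \<noteq> {}" using SLF_rule_idle[OF rule] assms by blast
  from rule[OF assms(1)] fin ne
  have "j \<in> active_jobs I x t \<and> (\<forall>i\<in>active_jobs I x t. \<eta> t j \<le> \<eta> t i)"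
  proof (cases rule: SLF_rule_cases)
    case (single k)
    then show ?thesis using single(4)[OF assms(2)] assms(3) by (auto split: if_splits)
  next
    case (parallel L)
    have "j \<in> L" using parallel(6)[OF assms(2)] assms(3) by (auto split: if_splits)
    then show ?thesis using parallel(2,4) by blast
  qed
  then show "e j t < p j" "i \<in> J \<Longrightarrow> e i t < p i \<Longrightarrow> \<eta> t j \<le> \<eta> t i"
    using assms by (auto simp: active_iff)
qed

lemma no_idle:
  assumes "0 \<le> t" "j \<in> J" "e j t < p j"
  shows "(\<Sum>k\<in>J. x k t) = 1"
proof -
  have ne: "active_jobs I x t \<noteq> {}" using assms active_iff by auto
  have sub: "active_jobs I x t \<subseteq> J" by (auto simp: active_jobs_def)
  from rule[OF assms(1)] fin ne show ?thesis
  proof (cases rule: SLF_rule_cases)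
    case (single j)
    have "(\<Sum>k\<in>J. x k t) = (\<Sum>k\<in>J. if k = j then 1 else 0)" by (intro sum.cong refl single(4))
    with single(1) sub fin show ?thesis by auto
  next
    case (parallel L)
    have "(\<Sum>k\<in>J. x k t) = (\<Sum>k\<in>J. if k \<in> L then 1 / real (card L) else 0)"
      by (intro sum.cong refl parallel(6))
    also have "\<dots> = (\<Sum>k\<in>L. 1 / real (card L))"
      using parallel(2) sub fin by (intro sum.mono_neutral_cong_right) auto
    also have "\<dots> = 1" using parallel(1,2) sub fin finite_subset[of L J] by auto
    finally show ?thesis .
  qed
qed

lemma known_processed_alone:
  assumes "0 \<le> t" "j \<in> J" "(1 - \<epsilon>) * p j \<le> e j t" "x j t \<noteq> 0" "k \<in> J" "k \<noteq> j"
  shows "x k t = 0"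
proof -
  have ne: "active_jobs I x t \<noteq> {}" using SLF_rule_idle[OF rule] assms by blast
  from rule[OF assms(1)] fin ne show ?thesis
  proof (cases rule: SLF_rule_cases)
    case (single i)
    show ?thesis using single(4)[of j] single(4)[of k] assms by (auto split: if_splits)
  next
    case (parallel L)
    show ?thesis using parallel(6)[of j] parallel(3)[of j] assms known_iff by (auto split: if_splits)
  qed
qed

text \<open>In the single branch the running job is known, so both rates are 0; in the parallel
  branch tied unknown jobs are chosen together or not at all.\<close>

lemma equal_estimate_equal_rate:
  assumes "0 \<le> t" "i \<in> J" "j \<in> J" "e i t < (1 - \<epsilon>) * p i" "e j t < (1 - \<epsilon>) * p j" "\<eta> t i = \<eta> t j"
  shows "x i t = x j t"
proof -
  have act: "i \<in> active_jobs I x t" "j \<in> active_jobs I x t"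
    using assms active_iff unknown_active by auto
  then have ne: "active_jobs I x t \<noteq> {}" by auto
  from rule[OF assms(1)] fin ne show ?thesis
  proof (cases rule: SLF_rule_cases)
    case (single k)
    show ?thesis using single(2) single(4)[of i] single(4)[of j] assms known_iff by (auto split: if_splits)
  next
    case (parallel L)
    have "i \<in> L \<longleftrightarrow> j \<in> L"
      using parallel(5)[of i j] parallel(5)[of j i] act assms known_iff by force
    then show ?thesis using parallel(6)[of i] parallel(6)[of j] assms by auto
  qed
qed

text \<open>If j led at t, take the last time s at which the two were level. On (s, t] job j leads,
  so its estimate is at least that of i. Whenever j runs it is also minimal, so the estimates tie
  and the rates agree. Hence j gains no more than i and no lead arises. For \<epsilon> = 0 all these
  estimates are 0 and the same tie applies.\<close>

lemma unknown_elapsed_le: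
  assumes "0 \<le> t" "i \<in> J" "j \<in> J" "e i t < (1 - \<epsilon>) * p i" "e j t < (1 - \<epsilon>) * p j"
  shows "e j t \<le> e i t"
proof (rule ccontr)
  assume "\<not> e j t \<le> e i t"
  moreover have "continuous_on {0..t} (\<lambda>u. e j u - e i u)"
    using e_cont by (intro continuous_on_diff) auto
  ultimately obtain s where s: "0 \<le> s" "s < t" "e j s - e i s = 0" "\<And>u. s < u \<Longrightarrow> u \<le> t \<Longrightarrow> 0 < e j u - e i u"
    using last_time_below[of 0 t "\<lambda>u. e j u - e i u" 0] assms(1) by auto
  have "x j u \<le> x i u" if u: "s < u" "u \<le> t" for u
  proof (cases "x j u = 0")
    case False
    have "0 \<le> u" using u s by auto
    have unk: "e i u < (1 - \<epsilon>) * p i" "e j u < (1 - \<epsilon>) * p j"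
      using e_mono[of u t i] e_mono[of u t j] u s assms by auto
    have "\<eta> u j \<le> \<eta> u i"
      using processed_minimal(2)[OF \<open>0 \<le> u\<close> assms(3) False assms(2)] unk unknown_active assms by blast
    moreover have "\<eta> u i \<le> \<eta> u j"
      using s(4)[OF u] eps unfolding estimate_unknown[OF unk(1)] estimate_unknown[OF unk(2)]
      by (intro mult_left_mono) auto
    ultimately show ?thesis
      using equal_estimate_equal_rate[OF \<open>0 \<le> u\<close> assms(2,3) unk] by simp
  qed (use x_nonneg u s in auto)
  then have "e j t - e j s \<le> e i t - e i s"
    using elapsed_increment_le[OF feas s(1), of t j i] s(2) by simp
  then show False using s(3) s(4)[of t] s(2) by simp
qed

lemma unknown_elapsed_eq:
  assumes "0 \<le> t" "i \<in> J" "j \<in> J" "e i t < (1 - \<epsilon>) * p i" "e j t < (1 - \<epsilon>) * p j"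
  shows "e j t = e i t"
  using unknown_elapsed_le[of t i j] unknown_elapsed_le[of t j i] assms by force

text \<open>Let v be the first time at which j reaches its threshold. Before v both jobs are unknown
  and hence level, so by continuity e_j(v) \<le> e_i(v), which is below the threshold of i and thus
  below that of j.\<close>

lemma longer_unknown:
  assumes t: "0 \<le> t" and ij: "i \<in> J" "j \<in> J" "p i \<le> p j" and unk: "e i t < (1 - \<epsilon>) * p i"
  shows "e j t < (1 - \<epsilon>) * p j"
proof (rule ccontr)
  assume "\<not> ?thesis"
  moreover have "0 < (1 - \<epsilon>) * p j"
  proof -
    have "0 < (1 - \<epsilon>) * p i" using unk e_nonneg[of t i] t by linarith
    then show ?thesis using ppos[OF ij(1)] ppos[OF ij(2)] by (simp add: zero_less_mult_iff)
  qed
  ultimately obtain v where v: "0 < v" "v \<le> t" "e j v = (1 - \<epsilon>) * p j"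
    "\<And>u. 0 \<le> u \<Longrightarrow> u < v \<Longrightarrow> e j u < (1 - \<epsilon>) * p j"
    using first_time_reaching[OF e_cont[of 0 t j], of "(1 - \<epsilon>) * p j"] t by auto
  have "e j u - e i u \<le> 0" if u: "0 \<le> u" "u < v" for u
  proof -
    have "e i u < (1 - \<epsilon>) * p i" using unk e_mono[of u t i] u v by auto
    then show ?thesis using unknown_elapsed_eq[of u i j] u v ij by auto
  qed
  then have "e j v - e i v \<le> 0"
    using v e_cont by (intro le_at_right_end[of v "\<lambda>u. e j u - e i u"] continuous_on_diff) auto
  moreover have "e i v \<le> e i t" using e_mono[of v t i] v by auto
  moreover have "(1 - \<epsilon>) * p i \<le> (1 - \<epsilon>) * p j" using ij eps by (intro mult_left_mono) auto
  ultimately show False using v unk by linarith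
qed

lemma overtaken_known:
  assumes "0 \<le> t" "i \<in> J" "j \<in> J" "p i \<le> p j" "(1 - \<epsilon>) * p i < e j t"
  shows "(1 - \<epsilon>) * p i \<le> e i t"
proof (rule ccontr)
  assume "\<not> ?thesis"
  then have unk: "e i t < (1 - \<epsilon>) * p i" by simp
  from longer_unknown[OF assms(1-4) unk] have "e j t = e i t"
    using unknown_elapsed_eq[of t i j] unk assms by auto
  with unk assms show False by auto
qed

text \<open>Once e_j exceeds (1 - \<epsilon>) p_i, job i is known and has at most \<epsilon> p_i
  left. An unknown j has estimate above \<epsilon> p_i, and so has a known j that is not yet close
  to completion. So j does not run just after the crossing and cannot have crossed.\<close>

lemma shorter_first:
  assumes t: "0 \<le> t" and ij: "i \<in> J" "j \<in> J" "p i < p j" and act: "e i t < p i"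
  shows "e j t \<le> (1 - \<epsilon>) * p i"
proof (rule ccontr)
  assume "\<not> ?thesis"
  then have gt: "(1 - \<epsilon>) * p i < e j t" by simp
  have c0: "0 \<le> (1 - \<epsilon>) * p i" using eps ppos[OF ij(1)] by simp
  have lt: "(1 - \<epsilon>) * p i < p j - \<epsilon> * p i" using ij by (simp add: algebra_simps)
  \<comment> \<open>The run is inspected only until e_j reaches d. Being below p_j - \<epsilon> p_i,
    this level leaves more than \<epsilon> p_i of job j; p_i < p_j makes room for it.\<close>
  obtain d where d: "(1 - \<epsilon>) * p i < d" "d < p j - \<epsilon> * p i" "d \<le> e j t"
    using dense[of "(1 - \<epsilon>) * p i" "min (e j t) (p j - \<epsilon> * p i)"] gt lt by auto
  obtain t' where t': "0 \<le> t'" "t' \<le> t" "e j t' = d"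
    using IVT'[of "e j" 0 d t] e_cont[of 0 t j] d c0 t by auto
  obtain s where s: "0 \<le> s" "s < t'" "e j s = (1 - \<epsilon>) * p i" "\<And>u. s < u \<Longrightarrow> u \<le> t' \<Longrightarrow> (1 - \<epsilon>) * p i < e j u"
    using last_time_below[OF e_cont[of 0 t' j], of "(1 - \<epsilon>) * p i"] c0 t' d by auto
  have "x j u = 0" if u: "s < u" "u \<le> t'" for u
  proof (rule ccontr)
    assume nz: "x j u \<noteq> 0"
    have u0: "0 \<le> u" using u s by auto
    have acti: "e i u < p i" using e_mono[of u t i] u0 u t' act by auto
    have ki: "(1 - \<epsilon>) * p i \<le> e i u" using overtaken_known[OF u0 ij(1,2)] ij s(4)[OF u] by auto
    have "\<eta> u j \<le> \<eta> u i" using processed_minimal(2)[OF u0 ij(2) nz ij(1) acti] .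
    then have le: "\<eta> u j \<le> \<epsilon> * p i" using ki by (simp add: estimate_known algebra_simps)
    \<comment> \<open>For \<epsilon> = 0 a known job is already finished, whereas i is
      active.\<close>
    have pos: "0 < \<epsilon>" using ki acti eps by (cases "\<epsilon> = 0") auto
    show False
    proof (cases "(1 - \<epsilon>) * p j \<le> e j u")
      case True
      have "e j u \<le> d" using e_mono[of u t' j] u0 u t' by auto
      with True le d show ?thesis by (simp add: estimate_known)
    next
      case False
      then have "0 < (1 - \<epsilon>) * p j" using e_nonneg[OF u0, of j] by linarith
      then have lt1: "\<epsilon> < 1" using eps by (cases "\<epsilon> = 1") auto
      have "\<epsilon> / (1 - \<epsilon>) * ((1 - \<epsilon>) * p i) < \<epsilon> / (1 - \<epsilon>) * e j u"
        using pos lt1 s(4)[OF u] by (intro mult_strict_left_mono) auto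
      with False le lt1 show ?thesis by (simp add: estimate_unknown)
    qed
  qed
  then have "e j t' = e j s" using elapsed_const[OF feas s(1), of t' j] s(2) by auto
  then show False using s(3) d t' by simp
qed

text \<open>Once two jobs of equal length are known, a lead of one over the other persists. As long
  as they are level, their rates have equal integrals on every interval, but never both are
  positive; hence neither is processed.\<close>

lemma tied_first:
  assumes t: "0 \<le> t" and ij: "i \<in> J" "j \<in> J" "i \<noteq> j" "p i = p j" and act: "e i t < p i" "e j t < p j"
  shows "min (e i t) (e j t) \<le> (1 - \<epsilon>) * p i"
proof (rule ccontr)
  let ?c = "(1 - \<epsilon>) * p i"
  let ?h = "\<lambda>u. min (e i u) (e j u)"
  assume "\<not> ?thesis"
  then have "?c < ?h t" by (simp only: not_le)
  moreover have "?h 0 \<le> ?c" using eps ppos[OF ij(1)] by simp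
  moreover have "continuous_on {0..t} ?h" using e_cont by (intro continuous_on_min) auto
  ultimately obtain s where s: "0 \<le> s" "s < t" "?h s = ?c" "\<And>u. s < u \<Longrightarrow> u \<le> t \<Longrightarrow> ?c < ?h u"
    using last_time_below[of 0 t ?h ?c] t by blast
  have both: "(1 - \<epsilon>) * p i \<le> e i u" "(1 - \<epsilon>) * p j \<le> e j u" "e i u < p i" "e j u < p j" "0 \<le> u"
    if "s \<le> u" "u \<le> t" for u
    using s(3) s(4)[of u] e_mono[of u t i] e_mono[of u t j] s(1) that act ij by (cases "s = u"; auto)+
  have behind: "x k u = 0" if u: "s \<le> u" "u \<le> t" and kl: "(k, l) \<in> {(i, j), (j, i)}" and lt: "e k u < e l u" for k l u
  proof (rule ccontr)
    assume "x k u \<noteq> 0"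
    then have "\<eta> u k \<le> \<eta> u l"
      using processed_minimal(2)[of u k l] both[OF u] kl ij by auto
    then show False using both[OF u] kl lt ij by (auto simp: estimate_known)
  qed
  have alone: "x i u = 0 \<or> x j u = 0" if "s \<le> u" "u \<le> t" for u
    using known_processed_alone[of u i j] both[OF that] ij by auto
  \<comment> \<open>A trailing job receives nothing, so at the first moment of catching up it would
    have its old amount, still below that of the leader.\<close>
  have lead_persists: "e k w < e l w" if u: "s \<le> u" "u \<le> w" "w \<le> t" and kl: "(k, l) \<in> {(i, j), (j, i)}"
    and lt: "e k u < e l u" for k l u w
  proof (rule ccontr)
    assume "\<not> e k w < e l w"
    moreover have "continuous_on {u..w} (\<lambda>u. e k u - e l u)"
      using e_cont u s(1) by (intro continuous_on_diff) auto
    ultimately obtain v where v: "u < v" "v \<le> w" "e k v - e l v = 0" "\<And>y. u \<le> y \<Longrightarrow> y < v \<Longrightarrow> e k y - e l y < 0"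
      using first_time_reaching[of u w "\<lambda>u. e k u - e l u" 0] u lt by auto
    have "e k y - e k u \<le> 0" if "u \<le> y" "y < v" for y
      using elapsed_const[OF feas, of u y k] behind[OF _ _ kl] v that u s(1) by auto
    \<comment> \<open>Replacing y by \<open>max y u\<close> extends the function constantly to the
      left of u, since \<open>le_at_right_end\<close> works on an interval that starts at 0.\<close>
    moreover have "continuous_on {0..v} (\<lambda>y. e k (max y u) - e k u)"
      using s(1) u v by (intro continuous_on_diff continuous_on_compose2[OF e_cont[of 0 v k]] continuous_intros) auto
    ultimately have "e k (max v u) - e k u \<le> 0"
      using v(1) u s(1) by (intro le_at_right_end[of v "\<lambda>y. e k (max y u) - e k u" 0]) (auto simp: max_def)
    then have "e k v \<le> e k u" using v(1) by (simp add: max_def)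
    moreover have "e l u \<le> e l v" using e_mono[of u v l] u s(1) v by auto
    ultimately show False using v(3) lt by linarith
  qed
  \<comment> \<open>As leads persist, the level times form an initial segment of [s, t]; z is its
    right end, or s if there is none.\<close>
  obtain z where z: "s \<le> z" "z \<le> t" "\<And>u. s \<le> u \<Longrightarrow> u < z \<Longrightarrow> e i u = e j u" "\<And>u. z < u \<Longrightarrow> u \<le> t \<Longrightarrow> e i u \<noteq> e j u"
  proof -
    let ?Z = "{u \<in> {s..t}. e i u = e j u}"
    show thesis
    proof (cases "?Z = {}")
      case True
      then show thesis using s(2) by (intro that[of s]) auto
    next
      case False
      have bdd: "bdd_above ?Z" by (rule bdd_aboveI[of _ t]) auto
      define z where "z = Sup ?Z"
      have "s \<le> z" using False cSup_upper[OF _ bdd] unfolding z_def by fastforce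
      moreover have "z \<le> t" unfolding z_def using False by (intro cSup_least) auto
      moreover have "e i u = e j u" if u: "s \<le> u" "u < z" for u
      proof (rule ccontr)
        assume ne: "e i u \<noteq> e j u"
        obtain w where "w \<in> ?Z" "u < w" using u less_cSup_iff[OF False bdd] unfolding z_def by auto
        then show False using lead_persists[of u w i j] lead_persists[of u w j i] ne u by fastforce
      qed
      moreover have "e i u \<noteq> e j u" if "z < u" "u \<le> t" for u
        using cSup_upper[OF _ bdd, of u] that \<open>s \<le> z\<close> unfolding z_def by force
      ultimately show thesis using that by blast
    qed
  qed
  have level: "e i u = e j u" if "s \<le> u" "u \<le> z" "s < z" for u
  proof (cases "u = z")
    case True
    have cont: "continuous_on {0..z} (\<lambda>y. e k (max y s) - e l (max y s))" for k l
      using s(1) z by (intro continuous_on_diff continuous_on_compose2[OF e_cont[of 0 z]] continuous_intros) auto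
    have "e k (max z s) - e l (max z s) \<le> 0" if "(k, l) \<in> {(i, j), (j, i)}" for k l
      using z(3) \<open>s < z\<close> s(1) that
      by (intro le_at_right_end[OF cont]) (auto simp: max_def)
    from this[of i j] this[of j i] show ?thesis using \<open>s < z\<close> True by (auto simp: max_def)
  qed (use z that in auto)
  have "e i z = e i s \<and> e j z = e j s"
  proof (cases "s < z")
    case True
    have int: "(\<lambda>u. x i u - x j u) integrable_on {s..z}"
      using feasible_integrable[OF feas s(1)] by (intro integrable_diff) auto
    have "integral {s..u} (\<lambda>u. x i u - x j u) = 0" if "u \<in> {s..z}" for u
      using integral_diff[OF feasible_integrable[OF feas s(1), of i u] feasible_integrable[OF feas s(1), of j u]]
        elapsed_split[OF feas s(1), of u i] elapsed_split[OF feas s(1), of u j] level[of u] level[of s] that True by auto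
    then have abs0: "((\<lambda>u. \<bar>x i u - x j u\<bar>) has_integral 0) {s..z}"
      by (intro zero_indefinite_integral_imp_abs[OF int]) auto
    have "\<bar>x i u - x j u\<bar> = x i u + x j u" if "u \<in> {s..z}" for u
      using alone[of u] x_nonneg[of u i] x_nonneg[of u j] that z s(1) by auto
    then have "((\<lambda>u. x i u + x j u) has_integral 0) {s..z}"
      by (rule has_integral_eq[OF _ abs0])
    then have "integral {s..z} (x i) + integral {s..z} (x j) = 0"
      using integral_add[OF feasible_integrable[OF feas s(1), of i z] feasible_integrable[OF feas s(1), of j z]]
      by (simp add: integral_unique)
    moreover have "0 \<le> integral {s..z} (x i)" "0 \<le> integral {s..z} (x j)"
      using x_nonneg s(1) by (auto intro!: integral_nonneg feasible_integrable[OF feas])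
    ultimately show ?thesis
      using elapsed_split[OF feas s(1) z(1), of i] elapsed_split[OF feas s(1) z(1), of j] by auto
  next
    case False then show ?thesis using z by auto
  qed
  then have hz: "?h z = ?c" using s(3) by simp
  then have "z \<noteq> t" using s(4)[of t] s(2) by auto
  then have "z < t" using z by simp
  \<comment> \<open>After z the two are never level again, so the job trailing at t trails
    throughout and is frozen. The minimum thus keeps the value it had at z, which is the value at
    s.\<close>
  have after: "e k t = e k z" if kl: "(k, l) \<in> {(i, j), (j, i)}" and lt: "e k t < e l t" for k l
  proof (rule elapsed_const[OF feas])
    fix u assume u: "z < u" "u \<le> t"
    have "e k u < e l u"
    proof (rule ccontr)
      assume "\<not> e k u < e l u"
      with z(4)[OF u] kl have "e l u < e k u" by force
      then show False using lead_persists[of u t l k] u z kl lt by fastforce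
    qed
    then show "x k u = 0" using behind[of u k l] u z kl by auto
  qed (use z s in auto)
  have "e i t \<noteq> e j t" using z(4)[of t] \<open>z < t\<close> by auto
  have "?h t = ?c"
  proof (cases "e i t < e j t")
    case True
    have "\<not> e j z < e i z" using lead_persists[of z t j i] True z by auto
    then show ?thesis using after[of i j] True hz by (auto simp: min_def split: if_splits)
  next
    case False
    then have lt: "e j t < e i t" using \<open>e i t \<noteq> e j t\<close> by simp
    have "\<not> e i z < e j z" using lead_persists[of z t i j] lt z by auto
    then show ?thesis using after[of j i] lt hz by (auto simp: min_def split: if_splits)
  qed
  then show False using s(4)[of t] s(2) by simp
qed

text \<open>While j is active the machine never idles, so the elapsed times add up to the clock
  time. They cannot exceed the total work, hence j finishes before
  \<open>sum p J + 1\<close>.\<close>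

lemma completes:
  assumes j: "j \<in> J"
  obtains c where "completes_at I x j c" "0 < c" "(\<Sum>i\<in>J. e i c) = c"
proof -
  have work: "(\<Sum>i\<in>J. e i t) = t" if t: "0 \<le> t" "\<And>u. 0 \<le> u \<Longrightarrow> u < t \<Longrightarrow> e j u < p j" for t
  proof -
    have "integral {0..t} (\<lambda>u. \<Sum>i\<in>J. x i u) = integral {0..t} (\<lambda>u. 1)"
      by (rule integral_spike[of "{t}"]) (use no_idle[OF _ j] t in auto)
    then show ?thesis using sum_elapsed[OF feas fin t(1)] t(1) by simp
  qed
  have P: "0 \<le> sum p J" using ppos by (auto intro!: sum_nonneg simp: less_imp_le)
  have "p j \<le> e j (sum p J + 1)"
  proof (rule ccontr)
    assume "\<not> ?thesis"
    then have "e j u < p j" if "0 \<le> u" "u \<le> sum p J + 1" for u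
      using e_mono[of u "sum p J + 1" j] that by linarith
    then have "(\<Sum>i\<in>J. e i (sum p J + 1)) = sum p J + 1" using P by (intro work) auto
    moreover have "(\<Sum>i\<in>J. e i (sum p J + 1)) \<le> sum p J" using P by (intro sum_mono e_le) auto
    ultimately show False by simp
  qed
  then obtain c where "completes_at I x j c" "0 < c"
    using completes_atI[OF feas j ppos[OF j], of "sum p J + 1"] P by auto
  then show thesis by (intro that[of c] work) (auto simp: completes_at_def)
qed

text \<open>Consider the first completion T. For p_i < p_j, \<open>shorter_first\<close> extended to
  T leaves j at most (1 - \<epsilon>) p_i, so i is the job that completes, and it adds p_i. For
  equal lengths \<open>tied_first\<close> gives the same bound for the smaller of the two
  amounts.\<close>

lemma pair_delay:
  assumes ij: "i \<in> J" "j \<in> J" "i \<noteq> j" "p i \<le> p j"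
    and ci: "completes_at I x i c" "0 < c" and dj: "completes_at I x j d" "0 < d"
  shows "e i d + e j c \<le> (2 - \<epsilon>) * p i"
proof -
  define T where "T = min c d"
  have T: "0 < T" using ci dj by (simp add: T_def)
  have act: "e i u < p i" "e j u < p j" if "0 \<le> u" "u < T" for u
    using ci dj that by (auto simp: T_def completes_at_def)
  have fin: "e i c = p i" "e j d = p j" "e i d \<le> p i" "e j c \<le> p j"
    using ci dj e_le ij by (auto simp: completes_at_def)
  have c2: "(2 - \<epsilon>) * p i = (1 - \<epsilon>) * p i + p i" by (simp add: algebra_simps)
  have c1: "(1 - \<epsilon>) * p i \<le> p i" using eps ppos[OF ij(1)] by (simp add: algebra_simps)
  show ?thesis
  proof (cases "p i < p j")
    case True
    have "e j T \<le> (1 - \<epsilon>) * p i"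
      by (rule le_at_right_end[OF e_cont T]) (use shorter_first[OF _ ij(1,2) True] act in auto)
    then show ?thesis using fin c1 c2 True by (auto simp: T_def min_def split: if_splits)
  next
    case False
    then have eq: "p i = p j" using ij by simp
    have "continuous_on {0..T} (\<lambda>u. min (e i u) (e j u))" using e_cont by (intro continuous_on_min) auto
    then have "min (e i T) (e j T) \<le> (1 - \<epsilon>) * p i"
      by (rule le_at_right_end[OF _ T]) (use tied_first[OF _ ij(1,2,3) eq] act in auto)
    then show ?thesis using fin c1 c2 eq by (auto simp: T_def min_def split: if_splits)
  qed
qed

lemma total_flow_le: "total_flow I x \<le> ennreal (pair_bound (2 - \<epsilon>) I)"
proof -
  have "\<forall>j\<in>J. \<exists>c. completes_at I x j c \<and> 0 < c \<and> (\<Sum>i\<in>J. e i c) = c"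
    using completes by blast
  then obtain c where c: "\<And>j. j \<in> J \<Longrightarrow> completes_at I x j (c j) \<and> 0 < c j \<and> (\<Sum>i\<in>J. e i (c j)) = c j"
    using bchoice[of J "\<lambda>j c. completes_at I x j c \<and> 0 < c \<and> (\<Sum>i\<in>J. e i c) = c"] by blast
  have "2 * (\<Sum>j\<in>J. c j) = 2 * (\<Sum>j\<in>J. \<Sum>i\<in>J. e i (c j))" using c by simp
  also have "\<dots> = (\<Sum>i\<in>J. \<Sum>j\<in>J. e i (c j) + e j (c i))" by (rule sum_symmetrize)
  also have "\<dots> \<le> 2 * pair_bound (2 - \<epsilon>) I"
    unfolding pair_bound_def sum_distrib_left
  proof (intro sum_mono)
    fix i j assume ij: "i \<in> J" "j \<in> J"
    show "e i (c j) + e j (c i) \<le> 2 * (if i = j then p i else (2 - \<epsilon>) / 2 * min (p i) (p j))"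
    proof (cases "i = j")
      case True then show ?thesis using c[OF ij(1)] by (auto simp: completes_at_def)
    next
      case False
      then show ?thesis
        using pair_delay[of i j "c i" "c j"] pair_delay[of j i "c j" "c i"] c[OF ij(1)] c[OF ij(2)] ij
        by (cases "p i \<le> p j") (auto simp: min_def)
    qed
  qed
  finally show ?thesis
    using total_flow_eq[OF batch, of x c] c by (auto intro!: ennreal_leI)
qed

end

lemma SLF_competitive:
  assumes "0 \<le> \<epsilon>" "\<epsilon> \<le> 1" "is_SLF batch_instances \<epsilon> A"
  shows "competitive batch_instances (2 - \<epsilon>) A"
  unfolding competitive_def
proof
  fix I assume I: "I \<in> batch_instances"
  interpret slf_run \<epsilon> I "A I"
    using assms I by unfold_locales (auto simp: is_SLF_def)
  have "total_flow I (A I) \<le> ennreal ((2 - \<epsilon>) * pair_bound 1 I)"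
    using total_flow_le pair_bound_le[OF I, of "2 - \<epsilon>"] eps by (auto intro: order_trans ennreal_leI)
  also have "\<dots> = ennreal (2 - \<epsilon>) * ennreal (pair_bound 1 I)"
    using eps pair_bound_nonneg[OF I, of 1] by (intro ennreal_mult) auto
  also have "\<dots> \<le> ennreal (2 - \<epsilon>) * opt_flow I"
    using opt_flow_ge[OF I] by (intro mult_left_mono) auto
  finally show "total_flow I (A I) \<le> ennreal (2 - \<epsilon>) * opt_flow I" .
qed

section \<open>Existence of a non-anticipating SLF schedule\<close>

text \<open>The explicit schedule below meets only two situations: a known job of minimum estimate,
  treated here, and active jobs that are all unknown with one common estimate, treated in
  \<open>SLF_rule_parallelI\<close>.\<close>

lemma SLF_rule_singleI:
  assumes "finite (jobs I)" "j \<in> active_jobs I x t" "known \<epsilon> I x j t"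
    "\<And>i. i \<in> active_jobs I x t \<Longrightarrow> estimate \<epsilon> I x t j \<le> estimate \<epsilon> I x t i"
    "\<And>k. k \<in> jobs I \<Longrightarrow> x k t = (if k = j then 1 else 0)"
  shows "SLF_rule \<epsilon> I x t"
proof -
  let ?A = "active_jobs I x t"
  let ?\<eta> = "estimate \<epsilon> I x t"
  define K where "K = {j\<in>?A. known \<epsilon> I x j t}"
  define U where "U = {j\<in>?A. \<not> known \<epsilon> I x j t}"
  have "finite ?A" using assms(1) by (auto simp: active_jobs_def)
  then have finK: "finite (?\<eta> ` K)" and finU: "finite (?\<eta> ` U)" by (auto simp: K_def U_def)
  have jK: "j \<in> K" using assms by (auto simp: K_def)
  have min: "?\<eta> j = Min (?\<eta> ` K)"
    using jK finK assms(4) by (intro Min_eqI[symmetric]) (auto simp: K_def)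
  have "U = {} \<or> Min (?\<eta> ` K) \<le> Min (?\<eta> ` U)"
    unfolding min[symmetric] using finU assms(4)
    by (cases "U = {}") (simp_all add: Min_ge_iff U_def)
  then show ?thesis
    unfolding SLF_rule_def Let_def K_def[symmetric] U_def[symmetric] using jK min assms(5) by auto
qed

lemma SLF_rule_parallelI:
  assumes "\<And>i. i \<in> active_jobs I x t \<Longrightarrow> \<not> known \<epsilon> I x i t"
    "\<And>i. i \<in> active_jobs I x t \<Longrightarrow> estimate \<epsilon> I x t i = c"
    "\<And>k. k \<in> jobs I \<Longrightarrow> x k t = (if k \<in> active_jobs I x t then 1 / real (card (active_jobs I x t)) else 0)"
  shows "SLF_rule \<epsilon> I x t"
proof -
  let ?A = "active_jobs I x t"
  let ?\<eta> = "estimate \<epsilon> I x t"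
  have K: "{j\<in>?A. known \<epsilon> I x j t} = {}" and U: "{j\<in>?A. \<not> known \<epsilon> I x j t} = ?A" using assms(1) by auto
  have "{j \<in> ?A. ?\<eta> j = Min (?\<eta> ` ?A)} = ?A"
  proof (cases "?A = {}")
    case False
    then have "?\<eta> ` ?A = {c}" using assms(2) by auto
    then show ?thesis using assms(2) by auto
  qed auto
  then show ?thesis unfolding SLF_rule_def Let_def K U using assms(3) by auto
qed

section \<open>An explicit SLF schedule\<close>

text \<open>Job indices break ties between equal lengths, so the order of the solo phases is
  determined.\<close>

definition prec :: "(nat \<Rightarrow> real) \<Rightarrow> nat \<Rightarrow> nat \<Rightarrow> bool" where
  "prec p i j \<longleftrightarrow> p i < p j \<or> p i = p j \<and> i < j"

lemma prec_irrefl [simp]: "\<not> prec p i i"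
  and prec_trans: "prec p i j \<Longrightarrow> prec p j k \<Longrightarrow> prec p i k"
  and prec_linear: "i \<noteq> j \<Longrightarrow> prec p i j \<or> prec p j i"
  and prec_le: "prec p i j \<Longrightarrow> p i \<le> p j"
  by (auto simp: prec_def)

text \<open>When job \<open>k\<close> begins to run alone, the shorter jobs are finished and all longer ones have
  received \<open>(1 - \<epsilon>) p k\<close>.\<close>

definition solo_start :: "real \<Rightarrow> nat set \<Rightarrow> (nat \<Rightarrow> real) \<Rightarrow> nat \<Rightarrow> real" where
  "solo_start \<epsilon> J p k = (\<Sum>j\<in>J. if prec p j k then p j else (1 - \<epsilon>) * p k)"

definition solo_end :: "real \<Rightarrow> nat set \<Rightarrow> (nat \<Rightarrow> real) \<Rightarrow> nat \<Rightarrow> real" where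
  "solo_end \<epsilon> J p k = solo_start \<epsilon> J p k + \<epsilon> * p k"

text \<open>Kept apart from the individual rates because its integral \<open>lev\<close> is the
  common level of all jobs whose solo phase has not begun. When all are done the division by 0 gives
  rate 0.\<close>

definition shared_rate :: "real \<Rightarrow> nat set \<Rightarrow> (nat \<Rightarrow> real) \<Rightarrow> real \<Rightarrow> real" where
  "shared_rate \<epsilon> J p t =
     (if \<exists>i\<in>J. solo_start \<epsilon> J p i \<le> t \<and> t < solo_end \<epsilon> J p i then 0
      else 1 / real (card {i\<in>J. t < solo_start \<epsilon> J p i}))"

definition slf_rate :: "real \<Rightarrow> nat set \<Rightarrow> (nat \<Rightarrow> real) \<Rightarrow> schedule" where
  "slf_rate \<epsilon> J p j t =
     (if j \<notin> J then 0 else if t < solo_start \<epsilon> J p j then shared_rate \<epsilon> J p t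
      else if t < solo_end \<epsilon> J p j then 1 else 0)"

lemma bounded_measurable_integrable:
  fixes f :: "real \<Rightarrow> real"
  assumes "f \<in> borel_measurable borel" "\<And>u. 0 \<le> f u" "\<And>u. f u \<le> 1"
  shows "f integrable_on {a..b}"
proof (rule measurable_bounded_by_integrable_imp_integrable)
  show "f \<in> borel_measurable (lebesgue_on {a..b})"
    using assms(1) by (simp add: borel_measurable_if_I lebesgue_on_UNIV_eq measurable_completion measurable_restrict_space1)
  show "norm (f u) \<le> 1" for u using assms by simp
qed (auto intro: integrable_on_const)

locale slf_construction =
  fixes \<epsilon> :: real and J :: "nat set" and p :: "nat \<Rightarrow> real"
  assumes eps: "0 \<le> \<epsilon>" "\<epsilon> \<le> 1" and fin: "finite J" and ppos: "j \<in> J \<Longrightarrow> 0 < p j"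
begin

abbreviation "S \<equiv> solo_start \<epsilon> J p"
abbreviation "F \<equiv> solo_end \<epsilon> J p"
abbreviation "y \<equiv> shared_rate \<epsilon> J p"
abbreviation "x \<equiv> slf_rate \<epsilon> J p"
abbreviation "e \<equiv> elapsed x"
abbreviation "lev t \<equiv> integral {0..t} y"

lemma threshold_mono: "p i \<le> p j \<Longrightarrow> (1 - \<epsilon>) * p i \<le> (1 - \<epsilon>) * p j"
  using eps by (intro mult_left_mono) auto

lemma threshold_le: "j \<in> J \<Longrightarrow> (1 - \<epsilon>) * p j \<le> p j"
  using eps ppos[of j] by (simp add: algebra_simps)

text \<open>The solo phase tops the share (1 - \<epsilon>) p_k of job k up to p_k. This form allows
  a termwise comparison with later starts.\<close>

lemma solo_end_eq: "k \<in> J \<Longrightarrow> F k = (\<Sum>j\<in>J. if prec p j k \<or> j = k then p j else (1 - \<epsilon>) * p k)"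
proof -
  assume k: "k \<in> J"
  have "(\<Sum>j\<in>J. if prec p j k \<or> j = k then p j else (1 - \<epsilon>) * p k) =
      (\<Sum>j\<in>J. (if prec p j k then p j else (1 - \<epsilon>) * p k) + (if j = k then \<epsilon> * p k else 0))"
    by (intro sum.cong) (auto simp: algebra_simps)
  also have "\<dots> = F k" using k fin by (simp add: sum.distrib solo_end_def solo_start_def)
  finally show ?thesis ..
qed

lemma solo_start_le_end: "k \<in> J \<Longrightarrow> S k \<le> F k"
  using eps ppos[of k] by (simp add: solo_end_def)

lemma solo_start_nonneg: "k \<in> J \<Longrightarrow> 0 \<le> S k"
  unfolding solo_start_def using eps ppos by (auto intro!: sum_nonneg mult_nonneg_nonneg simp: less_imp_le)

text \<open>The sums compare term by term: a job finished by the end of i counts fully on both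
  sides, and any other j has p_i \<le> p_j, so (1 - \<epsilon>) p_i is at most p_j and at most (1 -
  \<epsilon>) p_k. Solo phases are therefore disjoint and ordered by \<open>prec\<close>.\<close>

lemma solo_end_le_start:
  assumes "i \<in> J" "k \<in> J" "prec p i k" shows "F i \<le> S k"
  unfolding solo_end_eq[OF assms(1)] solo_start_def
proof (rule sum_mono)
  fix j assume j: "j \<in> J"
  show "(if prec p j i \<or> j = i then p j else (1 - \<epsilon>) * p i) \<le> (if prec p j k then p j else (1 - \<epsilon>) * p k)"
  proof (cases "prec p j i \<or> j = i")
    case True
    then show ?thesis using assms prec_trans[of p j i k] by auto
  next
    case False
    then have "p i \<le> p j" using prec_linear[of i j p] prec_le by auto
    then have "(1 - \<epsilon>) * p i \<le> p j" using threshold_mono[of i j] threshold_le[OF j] by simp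
    then show ?thesis using False threshold_mono[of i k] prec_le[OF assms(3)] by auto
  qed
qed

lemma solo_start_mono: "i \<in> J \<Longrightarrow> k \<in> J \<Longrightarrow> prec p i k \<Longrightarrow> S i \<le> S k"
  using solo_end_le_start[of i k] solo_start_le_end[of i] by simp

lemma solo_start_mono': "i \<in> J \<Longrightarrow> k \<in> J \<Longrightarrow> \<not> prec p k i \<Longrightarrow> S i \<le> S k"
  using solo_start_mono[of i k] prec_linear[of i k p] by (cases "i = k") auto

lemma shared_rate_nonneg: "0 \<le> y t" and shared_rate_le: "y t \<le> 1"
  by (auto simp: shared_rate_def divide_le_eq)

lemma rate_nonneg: "0 \<le> x j t" and rate_le: "x j t \<le> 1"
  using shared_rate_nonneg shared_rate_le by (auto simp: slf_rate_def)

lemma shared_rate_measurable [measurable]: "y \<in> borel_measurable borel"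
proof -
  have card: "real (card {i\<in>J. t < S i}) = (\<Sum>i\<in>J. if t < S i then 1 else 0)" for t
    using fin by (simp add: sum.If_cases Int_def)
  show ?thesis
    unfolding shared_rate_def[abs_def] card using fin by measurable
qed

lemma rate_measurable [measurable]: "x j \<in> borel_measurable borel"
  unfolding slf_rate_def[abs_def] by measurable

lemma shared_rate_integrable: "y integrable_on {a..b}"
  using shared_rate_nonneg shared_rate_le by (intro bounded_measurable_integrable) auto

lemma rate_integrable: "x j integrable_on {a..b}"
  using rate_nonneg rate_le by (intro bounded_measurable_integrable) auto

lemma rate_solo:
  assumes "i \<in> J" "S i \<le> t" "t < F i" "j \<in> J"
  shows "x j t = (if j = i then 1 else 0)"
proof -
  consider "j = i" | "prec p j i" | "prec p i j" using prec_linear by blast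
  then show ?thesis
  proof cases
    case 2
    then show ?thesis using assms solo_end_le_start[of j i] solo_start_le_end[of j] by (auto simp: slf_rate_def)
  next
    case 3
    then have "t < S j" using assms solo_end_le_start[of i j] by auto
    then show ?thesis using assms 3 by (auto simp: slf_rate_def shared_rate_def)
  qed (use assms in \<open>auto simp: slf_rate_def\<close>)
qed

lemma rate_shared:
  assumes "\<not> (\<exists>i\<in>J. S i \<le> t \<and> t < F i)" "j \<in> J"
  shows "x j t = (if t < S j then 1 / real (card {i\<in>J. t < S i}) else 0)"
  using assms by (auto simp: slf_rate_def shared_rate_def)

lemma sum_rate: "(\<Sum>j\<in>J. x j t) = (if \<exists>k\<in>J. t < F k then 1 else 0)"
proof (cases "\<exists>i\<in>J. S i \<le> t \<and> t < F i")
  case True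
  then obtain i where i: "i \<in> J" "S i \<le> t" "t < F i" by auto
  then have "(\<Sum>j\<in>J. x j t) = (\<Sum>j\<in>J. if j = i then 1 else 0)" by (intro sum.cong refl rate_solo)
  with i fin show ?thesis by auto
next
  case False
  let ?U = "{i\<in>J. t < S i}"
  have "(\<Sum>j\<in>J. x j t) = (\<Sum>j\<in>J. if t < S j then 1 / real (card ?U) else 0)"
    using False by (intro sum.cong refl rate_shared)
  also have "\<dots> = (\<Sum>j\<in>?U. 1 / real (card ?U))"
    using fin by (intro sum.mono_neutral_cong_right) auto
  also have "\<dots> = (if ?U = {} then 0 else 1)"
    using fin by auto
  also have "?U = {} \<longleftrightarrow> \<not> (\<exists>k\<in>J. t < F k)"
    using False solo_start_le_end by (force simp: not_less)
  finally show ?thesis by auto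
qed

lemma elapsed_before: "j \<in> J \<Longrightarrow> t \<le> S j \<Longrightarrow> e j t = lev t"
  unfolding elapsed_def by (rule integral_spike[of "{t}"]) (auto simp: slf_rate_def)

lemma elapsed_combine: "0 \<le> s \<Longrightarrow> s \<le> t \<Longrightarrow> e j t = e j s + integral {s..t} (x j)"
  unfolding elapsed_def by (intro Henstock_Kurzweil_Integration.integral_combine[symmetric] rate_integrable)

lemma elapsed_during:
  assumes "j \<in> J" "S j \<le> t" "t \<le> F j" shows "e j t = lev (S j) + (t - S j)"
proof -
  have "integral {S j..t} (x j) = integral {S j..t} (\<lambda>_. 1)"
    by (rule integral_spike[of "{t}"]) (use assms in \<open>auto simp: slf_rate_def\<close>)
  then show ?thesis
    using elapsed_combine[of "S j" t j] elapsed_before[of j "S j"] solo_start_nonneg assms by auto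
qed

lemma elapsed_after:
  assumes "j \<in> J" "F j \<le> t" shows "e j t = lev (S j) + \<epsilon> * p j"
proof -
  have "integral {F j..t} (x j) = integral {F j..t} (\<lambda>_. 0)"
    by (rule integral_cong) (use assms solo_start_le_end[of j] in \<open>auto simp: slf_rate_def\<close>)
  then show ?thesis
    using elapsed_combine[of "F j" t j] elapsed_during[of j "F j"] solo_start_nonneg[of j] solo_start_le_end[of j] assms
    by (auto simp: solo_end_def)
qed

lemma lev_mono: "0 \<le> s \<Longrightarrow> s \<le> t \<Longrightarrow> lev t = lev s + integral {s..t} y"
  by (intro Henstock_Kurzweil_Integration.integral_combine[symmetric] shared_rate_integrable)

text \<open>Up to \<open>S k\<close> the machine never idles, so the elapsed times at \<open>S k\<close> add up to \<open>S k\<close>.\<close>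

lemma lev_solo_start: "k \<in> J \<Longrightarrow> lev (S k) = (1 - \<epsilon>) * p k"
proof (induction "card {j\<in>J. prec p j k}" arbitrary: k rule: less_induct)
  case less
  have finished: "e j (S k) = p j" if j: "j \<in> J" "prec p j k" for j
  proof -
    have "{i\<in>J. prec p i j} \<subset> {i\<in>J. prec p i k}"
      using j prec_trans[of p _ j k] prec_irrefl[of p j] by blast
    then have "lev (S j) = (1 - \<epsilon>) * p j"
      using less.hyps[of j] j psubset_card_mono[of "{i\<in>J. prec p i k}"] fin by auto
    then show ?thesis
      using elapsed_after[OF j(1) solo_end_le_start[OF j(1) less.prems j(2)]] by (simp add: algebra_simps)
  qed
  have "(\<Sum>j\<in>J. e j (S k)) = integral {0..S k} (\<lambda>t. \<Sum>j\<in>J. x j t)"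
    unfolding elapsed_def using fin rate_integrable by (intro integral_sum[symmetric]) auto
  also have "\<dots> = integral {0..S k} (\<lambda>t. 1)"
    using less.prems solo_start_le_end[of k]
    by (intro integral_spike[of "{S k}"]) (auto simp: sum_rate not_less intro: antisym order_trans)
  also have "\<dots> = S k" using solo_start_nonneg less.prems by simp
  finally have "S k = (\<Sum>j\<in>J. e j (S k))" ..
  also have "\<dots> = (\<Sum>j\<in>J. if prec p j k then p j else lev (S k))"
    using finished less.prems solo_start_mono'[of k] by (intro sum.cong) (auto intro: elapsed_before)
  \<comment> \<open>Against the definition of \<open>S k\<close>, the predecessors cancel and every
    other job contributes the same difference. Job k itself is among them, so the difference is
    0.\<close>
  finally have "0 = (\<Sum>j\<in>J. (if prec p j k then p j else lev (S k)) - (if prec p j k then p j else (1 - \<epsilon>) * p k))"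
    unfolding solo_start_def[of \<epsilon> J p k] sum_subtractf by simp
  also have "\<dots> = (\<Sum>j\<in>{j\<in>J. \<not> prec p j k}. lev (S k) - (1 - \<epsilon>) * p k)"
    using fin by (intro sum.mono_neutral_cong_right) auto
  also have "\<dots> = real (card {j\<in>J. \<not> prec p j k}) * (lev (S k) - (1 - \<epsilon>) * p k)" by simp
  finally show ?case using less.prems fin by auto
qed

lemma elapsed_le:
  assumes "j \<in> J" "0 \<le> t" shows "e j t \<le> p j"
proof -
  have "e j t \<le> e j (max t (F j))"
    using elapsed_combine[of t "max t (F j)" j] assms rate_nonneg
    by (auto intro!: integral_nonneg rate_integrable)
  also have "\<dots> = p j" using elapsed_after[of j] lev_solo_start assms by (simp add: algebra_simps)
  finally show ?thesis .
qed

lemma slf_rate_feasible: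
  assumes "jobs I = J" "ptime I = p" "\<And>j. j \<in> J \<Longrightarrow> release I j = 0"
  shows "feasible I x"
  unfolding feasible_def using assms rate_nonneg rate_integrable elapsed_le sum_rate
  by (auto simp: slf_rate_def)

text \<open>In the solo phase of i, every other active job comes later in \<open>prec\<close> and
  rests at level (1 - \<epsilon>) p_i. Known or unknown, its estimate is at least \<epsilon> p_i,
  while i has at most that much left. Outside solo phases the active jobs are those not yet started,
  all level and strictly below their thresholds.\<close>

lemma slf_rate_rule:
  assumes I: "jobs I = J" "ptime I = p" "\<And>j. j \<in> J \<Longrightarrow> release I j = 0" and t: "0 \<le> t"
  shows "SLF_rule \<epsilon> I x t"
proof -
  have act: "j \<in> active_jobs I x t \<longleftrightarrow> j \<in> J \<and> e j t < p j" for j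
    using I t by (auto simp: active_jobs_def remaining_def)
  have known: "known \<epsilon> I x j t \<longleftrightarrow> (1 - \<epsilon>) * p j \<le> e j t" for j
    using I by (auto simp: known_def remaining_def algebra_simps)
  have finished: "e j t = p j" if "j \<in> J" "F j \<le> t" for j
    using elapsed_after[OF that] lev_solo_start that by (simp add: algebra_simps)
  show ?thesis
  proof (cases "\<exists>i\<in>J. S i \<le> t \<and> t < F i")
    case True
    then obtain i where i: "i \<in> J" "S i \<le> t" "t < F i" by auto
    have ei: "e i t = (1 - \<epsilon>) * p i + (t - S i)" using elapsed_during[of i t] lev_solo_start i by simp
    have rem: "p i - e i t \<le> \<epsilon> * p i" using ei i by (simp add: algebra_simps)
    have "integral {S i..t} y = integral {S i..t} (\<lambda>_. 0)"
      by (rule integral_cong) (use i in \<open>auto simp: shared_rate_def\<close>)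
    then have lev: "lev t = (1 - \<epsilon>) * p i"
      using lev_mono[of "S i" t] solo_start_nonneg i lev_solo_start by auto
    have esti: "estimate \<epsilon> I x t i = p i - e i t"
      using ei i I by (simp add: estimate_def known remaining_def)
    show ?thesis
    proof (rule SLF_rule_singleI[of I i])
      show "i \<in> active_jobs I x t" using ei i by (auto simp: act solo_end_def algebra_simps)
      show "estimate \<epsilon> I x t i \<le> estimate \<epsilon> I x t j" if j: "j \<in> active_jobs I x t" for j
      proof (cases "j = i")
        case False
        have jJ: "j \<in> J" using j act by auto
        have "\<not> prec p j i"
          using finished[of j] solo_end_le_start[of j i] i j act by force
        then have ij: "prec p i j" using False prec_linear[of i j p] by auto
        then have "t \<le> S j" using solo_end_le_start[OF i(1) jJ] i by auto
        then have ej: "e j t = (1 - \<epsilon>) * p i" using elapsed_before[OF jJ] lev by simp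
        show ?thesis
        proof (cases "known \<epsilon> I x j t")
          case True
          have "\<epsilon> * p i \<le> p j - e j t" using ej prec_le[OF ij] by (simp add: algebra_simps)
          then show ?thesis using True rem unfolding esti by (simp add: estimate_def remaining_def I)
        next
          case False
          then have "\<epsilon> \<noteq> 1" using ej by (auto simp: known)
          then have "\<epsilon> / (1 - \<epsilon>) * e j t = \<epsilon> * p i" using ej by simp
          then show ?thesis using False rem unfolding esti by (simp add: estimate_def)
        qed
      qed simp
    qed (use ei i I fin rate_solo[OF i] known in auto)
  next
    case False
    let ?U = "{i\<in>J. t < S i}"
    \<comment> \<open>Strictness: up to the next start \<tau> the shared rate is a positive
      constant, so the level still rises before it reaches the threshold at
      \<open>S k\<close>.\<close>
    have lvl: "lev t < (1 - \<epsilon>) * p k" if k: "k \<in> ?U" for k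
    proof -
      define \<tau> where "\<tau> = Min (S ` ?U)"
      have "\<tau> \<in> S ` ?U" unfolding \<tau>_def using fin k by (intro Min_in) auto
      then have \<tau>: "t < \<tau>" "\<And>i. i \<in> ?U \<Longrightarrow> \<tau> \<le> S i"
        using fin by (auto simp: \<tau>_def)
      have const: "y u = 1 / real (card ?U)" if u: "u \<in> {t..<\<tau>}" for u
      proof -
        have same: "u < S i \<longleftrightarrow> t < S i" if "i \<in> J" for i
          using \<tau>(2)[of i] u that by (cases "t < S i") auto
        then have "{i\<in>J. u < S i} = ?U" by auto
        moreover have "\<not> (\<exists>i\<in>J. S i \<le> u \<and> u < F i)"
          using False same u by (force simp: not_less)
        ultimately show ?thesis by (auto simp: shared_rate_def)
      qed
      have "integral {t..\<tau>} y = integral {t..\<tau>} (\<lambda>_. 1 / real (card ?U))"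
        by (rule integral_spike[of "{\<tau>}"]) (use const in auto)
      moreover have "0 < card ?U" using k fin by (auto simp: card_gt_0_iff)
      ultimately have "0 < integral {t..\<tau>} y" using \<tau>(1) by simp
      then have "lev t < lev \<tau>" using lev_mono[of t \<tau>] t \<tau>(1) by auto
      also have "\<dots> \<le> lev (S k)"
        using lev_mono[of \<tau> "S k"] \<tau>(1) \<tau>(2)[OF k] t shared_rate_nonneg
        by (auto intro!: integral_nonneg shared_rate_integrable)
      also have "\<dots> = (1 - \<epsilon>) * p k" using k lev_solo_start by auto
      finally show ?thesis .
    qed
    have active: "active_jobs I x t = ?U"
    proof (intro set_eqI iffI)
      fix j assume "j \<in> active_jobs I x t"
      then show "j \<in> ?U" using finished[of j] False act by force
    next
      fix j assume j: "j \<in> ?U"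
      then show "j \<in> active_jobs I x t"
        using lvl[OF j] elapsed_before[of j t] threshold_le[of j] act by auto
    qed
    have lev_eq: "e j t = lev t" if "j \<in> ?U" for j using elapsed_before[of j t] that by auto
    show ?thesis
    proof (rule SLF_rule_parallelI)
      show "\<not> known \<epsilon> I x j t" if "j \<in> active_jobs I x t" for j
        using lvl[of j] lev_eq[of j] that unfolding active known by simp
      then show "estimate \<epsilon> I x t j = \<epsilon> / (1 - \<epsilon>) * lev t" if "j \<in> active_jobs I x t" for j
        using that lev_eq[of j] unfolding active by (simp add: estimate_def)
    qed (use rate_shared[OF False] I active in auto)
  qed
qed

lemma known_after_solo_start:
  assumes "j \<in> J" "S j \<le> t"
  shows "(1 - \<epsilon>) * p j \<le> e j t"
proof -
  have "e j (S j) \<le> e j t"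
    using elapsed_combine[of "S j" t j] solo_start_nonneg[of j] assms rate_nonneg
    by (auto intro!: integral_nonneg rate_integrable)
  then show ?thesis using elapsed_before[of j "S j"] lev_solo_start[of j] assms by auto
qed

text \<open>If j has not started, neither has i; both are then level, and the threshold of j is the
  lower one.\<close>

lemma known_downward:
  assumes "i \<in> J" "j \<in> J" "prec p j i" "0 \<le> t" "(1 - \<epsilon>) * p i \<le> e i t"
  shows "(1 - \<epsilon>) * p j \<le> e j t"
proof (cases "t \<le> S j")
  case True
  then have "e j t = e i t" using elapsed_before[of j t] elapsed_before[of i t] solo_start_mono[of j i] assms by auto
  then show ?thesis using assms threshold_mono[of j i] prec_le[of p j i] by auto
next
  case False
  then show ?thesis using known_after_solo_start[of j t] assms by simp
qed

end

text \<open>B is the set of jobs known at t in both runs. It is downward closed under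
  \<open>prec\<close>, so starts and ends of its members depend only on lengths inside B. Jobs
  outside B start after t in both runs. Up to t the rates consult nothing else.\<close>

lemma slf_rate_nonanticipating:
  assumes "slf_construction \<epsilon> J p" "slf_construction \<epsilon> J q" "0 \<le> t"
    and B: "\<And>j. j \<in> J \<Longrightarrow> (1 - \<epsilon>) * p j \<le> elapsed (slf_rate \<epsilon> J p) j t \<longleftrightarrow> j \<in> B"
           "\<And>j. j \<in> J \<Longrightarrow> (1 - \<epsilon>) * q j \<le> elapsed (slf_rate \<epsilon> J q) j t \<longleftrightarrow> j \<in> B"
           "\<And>j. j \<in> J \<Longrightarrow> j \<in> B \<Longrightarrow> p j = q j"
    and s: "0 \<le> s" "s \<le> t"
  shows "elapsed (slf_rate \<epsilon> J p) j s = elapsed (slf_rate \<epsilon> J q) j s"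
proof -
  interpret P: slf_construction \<epsilon> J p by fact
  interpret Q: slf_construction \<epsilon> J q by fact
  have "(prec p j i \<longleftrightarrow> prec q j i) \<and> (prec p j i \<longrightarrow> p j = q j)" if "i \<in> J" "i \<in> B" "j \<in> J" for i j
  proof (cases "j \<in> B")
    case True
    then show ?thesis using B(3) that by (simp add: prec_def)
  next
    case False
    then have "\<not> prec p j i" "\<not> prec q j i"
      using P.known_downward[of i j t] Q.known_downward[of i j t] B(1,2)[of i] B(1,2)[of j] that assms(3) by blast+
    then show ?thesis by simp
  qed
  then have start: "P.S i = Q.S i" if "i \<in> J" "i \<in> B" for i
    unfolding solo_start_def using B(3) that by (intro sum.cong) auto
  then have finish: "P.F i = Q.F i" if "i \<in> J" "i \<in> B" for i
    unfolding solo_end_def using B(3) that by auto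
  have late: "t < P.S i" "t < Q.S i" if "i \<in> J" "i \<notin> B" for i
    using P.known_after_solo_start[of i t] Q.known_after_solo_start[of i t] B that by (force simp: not_less)+
  have Sless: "u < P.S i \<longleftrightarrow> u < Q.S i" if "u \<le> t" "i \<in> J" for u i
    using start[of i] late[of i] that by (cases "i \<in> B") auto
  have Fless: "P.S i \<le> u \<and> u < P.F i \<longleftrightarrow> Q.S i \<le> u \<and> u < Q.F i" if "u \<le> t" "i \<in> J" for u i
    using start[of i] finish[of i] late[of i] that by (cases "i \<in> B") auto
  have shared: "P.y u = Q.y u" if "u \<le> t" for u
    unfolding shared_rate_def using Sless[OF that] Fless[OF that] by (simp cong: conj_cong)
  have "P.x j u = Q.x j u" if "u \<le> t" for u
    unfolding slf_rate_def using Sless[OF that, of j] Fless[OF that, of j] shared[OF that] by (auto simp: not_less)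
  then show ?thesis unfolding elapsed_def using s by (intro integral_cong) auto
qed

lemma SLF_exists:
  assumes "0 \<le> \<epsilon>" "\<epsilon> \<le> 1"
  defines "A \<equiv> \<lambda>I. slf_rate \<epsilon> (jobs I) (ptime I)"
  shows "eps_clairvoyant batch_instances \<epsilon> A" "is_SLF batch_instances \<epsilon> A"
proof -
  have con: "slf_construction \<epsilon> (jobs I) (ptime I)" if "I \<in> batch_instances" for I
    using assms that batch_finite batch_ptime_pos by unfold_locales auto
  have feas: "feasible I (A I)" if "I \<in> batch_instances" for I
    unfolding A_def using slf_construction.slf_rate_feasible[OF con[OF that]] batch_release[OF that] by auto
  show "is_SLF batch_instances \<epsilon> A"
    unfolding is_SLF_def SLF_schedule_def A_def
    using feas[unfolded A_def] slf_construction.slf_rate_rule[OF con] batch_release by auto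
  show "eps_clairvoyant batch_instances \<epsilon> A"
    unfolding eps_clairvoyant_def
  proof (intro conjI ballI allI impI feas)
    fix I I' t s j
    assume I: "I \<in> batch_instances" "I' \<in> batch_instances" and t: "0 \<le> (t::real)"
      and obs: "\<forall>s\<in>{0..t}. observation \<epsilon> I (A I) s = observation \<epsilon> I' (A I') s" and s: "s \<in> {0..t}"
    \<comment> \<open>The observation at the last time t is enough: it fixes the job set, the known
      jobs and their lengths.\<close>
    have obs_t: "observation \<epsilon> I (A I) t i = observation \<epsilon> I' (A I') t i" for i
      using obs t by (metis atLeastAtMost_iff order_refl)
    have obs_eq: "observation \<epsilon> L (A L) t i = (if i \<in> jobs L then
       Some (if (1 - \<epsilon>) * ptime L i \<le> elapsed (A L) i t then Some (ptime L i) else None) else None)"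
      if "L \<in> batch_instances" for L i
      using that t batch_release[OF that] by (auto simp: observation_def known_def remaining_def algebra_simps)
    note o = obs_t[unfolded obs_eq[OF I(1)] obs_eq[OF I(2)]]
    have J: "jobs I' = jobs I"
    proof (rule set_eqI)
      fix i show "i \<in> jobs I' \<longleftrightarrow> i \<in> jobs I" using o[of i] by (auto split: if_splits)
    qed
    have con': "slf_construction \<epsilon> (jobs I) (ptime I')" using con[OF I(2)] J by simp
    show "elapsed (A I) j s = elapsed (A I') j s"
      unfolding A_def J
    proof (rule slf_rate_nonanticipating[OF con[OF I(1)] con' t, where B = "{i. (1 - \<epsilon>) * ptime I i \<le> elapsed (A I) i t}"])
      fix i assume i: "i \<in> jobs I"
      show "(1 - \<epsilon>) * ptime I' i \<le> elapsed (slf_rate \<epsilon> (jobs I) (ptime I')) i t \<longleftrightarrow> i \<in> {i. (1 - \<epsilon>) * ptime I i \<le> elapsed (A I) i t}"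
        using o[of i] i J by (auto simp: A_def split: if_splits)
      show "ptime I i = ptime I' i" if "i \<in> {i. (1 - \<epsilon>) * ptime I i \<le> elapsed (A I) i t}"
        using o[of i] i J that by (auto split: if_splits)
    qed (use s in \<open>auto simp: A_def\<close>)
  qed
qed

text \<open>With \<epsilon> = 1 every length is visible, and the SLF bound has the coefficient 2 - 1
  = 1 of the lower bound.\<close>

lemma opt_flow_le:
  assumes "I \<in> batch_instances"
  shows "opt_flow I \<le> ennreal (pair_bound 1 I)"
proof -
  let ?A = "\<lambda>I. slf_rate 1 (jobs I) (ptime I)"
  interpret slf_run 1 I "?A I"
    using SLF_exists(2)[of 1] assms by unfold_locales (auto simp: is_SLF_def)
  have "opt_flow I \<le> total_flow I (?A I)" unfolding opt_flow_def using feas by (intro INF_lower) auto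
  with total_flow_le show ?thesis by simp
qed

section \<open>The randomized lower bound\<close>

lemma stays_below:
  assumes "feasible I x" "0 \<le> s" "elapsed x l s < c"
  obtains d where "0 < d" "\<And>u. s \<le> u \<Longrightarrow> u \<le> s + d \<Longrightarrow> elapsed x l u < c"
proof (cases "elapsed x l (s + 1) < c")
  case True
  show thesis
  proof (rule that[of 1])
    fix u assume "s \<le> u" "u \<le> s + 1"
    then show "elapsed x l u < c"
      using elapsed_mono[OF assms(1), of u "s + 1" l] assms(2) True by linarith
  qed simp
next
  case False
  then obtain v where "s < v" "\<And>u. s \<le> u \<Longrightarrow> u < v \<Longrightarrow> elapsed x l u < c"
    using first_time_reaching[OF elapsed_continuous[OF assms(1,2), of "s + 1" l], of c] assms(3)
    by (metis le_add_same_cancel1 linorder_not_less zero_le_one)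
  then show thesis by (intro that[of "(v - s) / 2"]) (auto simp: field_simps)
qed

text \<open>Continuous induction. Equal observations give equal elapsed times and vice versa, a
  circle that is broken at the supremum b of the times up to which observations agree. Equality of
  elapsed times reaches b by continuity, and agreement of observations extends beyond b. Jobs of
  different lengths stay below both thresholds up to T.\<close>

lemma indistinguishable_runs:
  assumes alg: "eps_clairvoyant batch_instances \<epsilon> A"
    and I: "I \<in> batch_instances" "I' \<in> batch_instances" "jobs I = jobs I'" and T: "0 \<le> T"
    and agree: "\<And>l. l \<in> jobs I \<Longrightarrow> ptime I l = ptime I' l \<or>
      elapsed (A I) l T < (1 - \<epsilon>) * ptime I l \<and> elapsed (A I) l T < (1 - \<epsilon>) * ptime I' l"
  shows "elapsed (A I) l T = elapsed (A I') l T"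
proof -
  let ?x = "A I" and ?x' = "A I'"
  have feas: "feasible I ?x" "feasible I' ?x'" using alg I by (auto simp: eps_clairvoyant_def)
  define same where "same u \<longleftrightarrow> observation \<epsilon> I ?x u = observation \<epsilon> I' ?x' u" for u
  have known_iff: "known \<epsilon> L y l u \<longleftrightarrow> (1 - \<epsilon>) * ptime L l \<le> elapsed y l u" for L y l u
    by (auto simp: known_def remaining_def algebra_simps)
  have sameI: "same u" if "0 \<le> u" "\<And>l. l \<in> jobs I \<Longrightarrow> ptime I l = ptime I' l \<and> (known \<epsilon> I ?x l u \<longleftrightarrow> known \<epsilon> I' ?x' l u)
       \<or> \<not> known \<epsilon> I ?x l u \<and> \<not> known \<epsilon> I' ?x' l u" for u
    unfolding same_def observation_def fun_eq_iff
    using that I batch_release[OF I(1)] batch_release[OF I(2)] by auto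
  have eq_before: "elapsed ?x l u = elapsed ?x' l u" if "0 \<le> s" "\<And>v. 0 \<le> v \<Longrightarrow> v \<le> s \<Longrightarrow> same v" "0 \<le> u" "u \<le> s" for s u l
    using alg I that unfolding eps_clairvoyant_def same_def by (metis atLeastAtMost_iff)
  have same_if_eq: "same u" if u: "0 \<le> u" "u \<le> T" and eq: "\<And>l. elapsed ?x l u = elapsed ?x' l u" for u
  proof (rule sameI[OF u(1)])
    fix l assume "l \<in> jobs I"
    from agree[OF this] show "ptime I l = ptime I' l \<and> (known \<epsilon> I ?x l u \<longleftrightarrow> known \<epsilon> I' ?x' l u)
       \<or> \<not> known \<epsilon> I ?x l u \<and> \<not> known \<epsilon> I' ?x' l u"
      using elapsed_mono[OF feas(1) u, of l] eq[of l] by (auto simp: known_iff)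
  qed
  define R where "R = {s \<in> {0..T}. \<forall>u. 0 \<le> u \<and> u \<le> s \<longrightarrow> same u}"
  have "same 0" using T by (intro same_if_eq) auto
  then have R0: "0 \<in> R" using T by (auto simp: R_def dest: order_antisym)
  have bdd: "bdd_above R" by (rule bdd_aboveI[of _ T]) (auto simp: R_def)
  define b where "b = Sup R"
  have b: "0 \<le> b" "b \<le> T"
    unfolding b_def using cSup_upper[OF R0 bdd] R0 by (auto intro!: cSup_least simp: R_def)
  have before: "same u" if u: "0 \<le> u" "u < b" for u
  proof -
    obtain s where "s \<in> R" "u < s" using less_cSupD[of R u] R0 u unfolding b_def by auto
    then show ?thesis using u by (simp add: R_def)
  qed
  have eq_b: "elapsed ?x l b = elapsed ?x' l b" for l
  proof (cases "b = 0")
    case False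
    have eq: "elapsed ?x l u = elapsed ?x' l u" if "0 \<le> u" "u < b" for u
      using eq_before[of u u l] before that by auto
    have "elapsed ?x l b - elapsed ?x' l b \<le> 0" "elapsed ?x' l b - elapsed ?x l b \<le> 0"
      using False b eq
      by (auto intro!: le_at_right_end[of b "\<lambda>u. elapsed ?x l u - elapsed ?x' l u"]
          le_at_right_end[of b "\<lambda>u. elapsed ?x' l u - elapsed ?x l u"]
          continuous_on_diff elapsed_continuous[OF feas(1)] elapsed_continuous[OF feas(2)] simp del: diff_le_0_iff_le)
    then show ?thesis by simp
  qed simp
  then have "same b" using same_if_eq b by simp
  with before have upto: "same u" if "0 \<le> u" "u \<le> b" for u using that by (cases "u = b") auto
  have "b = T"
  proof (rule ccontr)
    assume "b \<noteq> T"
    with b have "b < T" by simp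
    \<comment> \<open>A known job stays known by monotonicity, an unknown one stays unknown for a
      while by \<open>stays_below\<close>; finitely many jobs then share a positive
      \<delta>.\<close>
    have "\<exists>d>0. \<forall>u. b \<le> u \<and> u \<le> b + d \<longrightarrow> ptime I l = ptime I' l \<and> (known \<epsilon> I ?x l u \<longleftrightarrow> known \<epsilon> I' ?x' l u)
       \<or> \<not> known \<epsilon> I ?x l u \<and> \<not> known \<epsilon> I' ?x' l u" if l: "l \<in> jobs I" for l
    proof (cases "known \<epsilon> I ?x l b \<and> ptime I l = ptime I' l")
      case True
      then have "known \<epsilon> I ?x l u \<and> known \<epsilon> I' ?x' l u" if "b \<le> u" for u
        using elapsed_mono[OF feas(1) b(1) that, of l] elapsed_mono[OF feas(2) b(1) that, of l] eq_b[of l]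
        by (auto simp: known_iff)
      with True show ?thesis by (intro exI[of _ 1]) auto
    next
      case False
      then have "elapsed ?x l b < (1 - \<epsilon>) * ptime I l" "elapsed ?x' l b < (1 - \<epsilon>) * ptime I' l"
        using agree[OF l] elapsed_mono[OF feas(1) b, of l] eq_b[of l] by (auto simp: known_iff)
      then obtain d d' where "0 < d" "\<And>u. b \<le> u \<Longrightarrow> u \<le> b + d \<Longrightarrow> elapsed ?x l u < (1 - \<epsilon>) * ptime I l"
        "0 < d'" "\<And>u. b \<le> u \<Longrightarrow> u \<le> b + d' \<Longrightarrow> elapsed ?x' l u < (1 - \<epsilon>) * ptime I' l"
        using stays_below[OF feas(1) b(1)] stays_below[OF feas(2) b(1)] by metis
      then show ?thesis by (intro exI[of _ "min d d'"]) (auto simp: known_iff not_le)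
    qed
    then obtain d where d: "\<And>l. l \<in> jobs I \<Longrightarrow> 0 < d l"
      "\<And>l u. l \<in> jobs I \<Longrightarrow> b \<le> u \<Longrightarrow> u \<le> b + d l \<Longrightarrow> ptime I l = ptime I' l \<and> (known \<epsilon> I ?x l u \<longleftrightarrow> known \<epsilon> I' ?x' l u)
       \<or> \<not> known \<epsilon> I ?x l u \<and> \<not> known \<epsilon> I' ?x' l u" by metis
    \<comment> \<open>Including T - b keeps b + \<delta> within the range of
      \<open>R\<close>.\<close>
    define \<delta> where "\<delta> = Min (insert (T - b) (d ` jobs I))"
    have fin: "finite (insert (T - b) (d ` jobs I))" using batch_finite[OF I(1)] by auto
    have "\<delta> \<in> insert (T - b) (d ` jobs I)" unfolding \<delta>_def using fin by (intro Min_in) auto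
    then have "0 < \<delta>" using d(1) \<open>b < T\<close> by auto
    have \<delta>: "\<delta> \<le> T - b" "\<And>l. l \<in> jobs I \<Longrightarrow> \<delta> \<le> d l" unfolding \<delta>_def using fin by (auto intro!: Min_le)
    have "same u" if "0 \<le> u" "u \<le> b + \<delta>" for u
    proof (cases "u \<le> b")
      case False
      then show ?thesis using that \<delta>(2) by (intro sameI d(2)) force+
    qed (use that upto in auto)
    then have "b + \<delta> \<in> R" using b \<delta> \<open>0 < \<delta>\<close> by (auto simp: R_def)
    then show False using cSup_upper[OF _ bdd] \<open>0 < \<delta>\<close> unfolding b_def by force
  qed
  then show ?thesis using eq_b by simp
qed

section \<open>Random integer lengths and the blind phase of a pair\<close>

definition grid_instance :: "nat \<Rightarrow> (nat \<Rightarrow> nat) \<Rightarrow> scheduling_instance" where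
  "grid_instance n c = \<lparr>jobs = {..<n}, release = (\<lambda>_. 0), ptime = (\<lambda>j. real (c j))\<rparr>"

lemma grid_instance_simps [simp]:
  "jobs (grid_instance n c) = {..<n}" "ptime (grid_instance n c) j = real (c j)"
  by (simp_all add: grid_instance_def)

text \<open>Extensional functions make the set finite, so expectations over the lengths are finite
  sums.\<close>

abbreviation grid :: "nat \<Rightarrow> nat \<Rightarrow> (nat \<Rightarrow> nat) set" where
  "grid n m \<equiv> PiE {..<n} (\<lambda>_. {1..m})"

lemma grid_instance_batch: "c \<in> grid n m \<Longrightarrow> grid_instance n c \<in> batch_instances"
  by (force simp: batch_instances_def valid_instance_def grid_instance_def PiE_def Pi_def)

lemma grid_update: "c \<in> grid n m \<Longrightarrow> i < n \<Longrightarrow> a \<in> {1..m} \<Longrightarrow> c(i := a) \<in> grid n m"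
  by (auto simp: PiE_def Pi_def extensional_def)

text \<open>The pair consumes \<open>(1 - \<epsilon>) k\<close> units of processing while both jobs are unknown, and after
  that the first one to complete still needs an \<open>\<epsilon>\<close>-fraction of its length.\<close>

lemma pair_blind_points:
  fixes A :: algorithm and c :: "nat \<Rightarrow> nat" and i j n :: nat
  defines "I \<equiv> \<lambda>a b. grid_instance n (c(i := a, j := b))"
  assumes eps: "0 \<le> \<epsilon>" "\<epsilon> < 1" and alg: "eps_clairvoyant batch_instances \<epsilon> A"
    and c: "c \<in> grid n m" and ij: "i < n" "j < n" "i \<noteq> j" and m: "1 \<le> m"
    and finite: "total_flow (I m m) (A (I m m)) \<noteq> \<infinity>"
  obtains X Y :: "nat \<Rightarrow> real" where "\<And>k. k < m \<Longrightarrow> 0 \<le> X k" "\<And>k. k < m \<Longrightarrow> 0 \<le> Y k" "\<And>k. k < m \<Longrightarrow> X k + Y k = real k"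
    "\<And>a b k s t. a \<in> {1..m} \<Longrightarrow> b \<in> {1..m} \<Longrightarrow> k < m \<Longrightarrow> X k < real a \<Longrightarrow> Y k < real b \<Longrightarrow>
       completes_at (I a b) (A (I a b)) i s \<Longrightarrow> completes_at (I a b) (A (I a b)) j t \<Longrightarrow>
       (1 - \<epsilon>) * real k + \<epsilon> * real (min a b) \<le> elapsed (A (I a b)) i t + elapsed (A (I a b)) j s"
proof -
  have batch: "I a b \<in> batch_instances" if "a \<in> {1..m}" "b \<in> {1..m}" for a b
    unfolding I_def using c ij that by (intro grid_instance_batch[of _ n m] grid_update)
  have feas: "feasible (I a b) (A (I a b))" if "a \<in> {1..m}" "b \<in> {1..m}" for a b
    using alg batch[OF that] by (auto simp: eps_clairvoyant_def)
  have pt: "ptime (I a b) l = (if l = j then real b else if l = i then real a else real (c l))" for a b l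
    by (simp add: I_def)
  have mm: "m \<in> {1..m}" using m by simp
  \<comment> \<open>The reference run gives both jobs the maximal length. \<open>X k\<close> and
    \<open>Y k\<close> are its elapsed times, rescaled by 1 - \<epsilon>, at a moment when the pair
    has received (1 - \<epsilon>) k units.\<close>
  let ?x = "A (I m m)"
  have feas0: "feasible (I m m) ?x" by (rule feas[OF mm mm])
  obtain C where C: "completes_at (I m m) ?x i C"
    using total_flow_finiteE[OF batch[OF mm mm] feas0 finite] ij by (auto simp: I_def)
  have "\<exists>t\<ge>0. elapsed ?x i t + elapsed ?x j t = (1 - \<epsilon>) * real k" if k: "k < m" for k
  proof -
    have "(1 - \<epsilon>) * real k \<le> 1 * real m" using k eps by (intro mult_mono) auto
    also have "\<dots> \<le> elapsed ?x i C + elapsed ?x j C"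
      using C elapsed_nonneg[OF feas0, of C j] ij by (auto simp: completes_at_def I_def)
    finally have le: "(1 - \<epsilon>) * real k \<le> elapsed ?x i C + elapsed ?x j C" .
    have "continuous_on {0..C} (\<lambda>t. elapsed ?x i t + elapsed ?x j t)"
      using elapsed_continuous[OF feas0] by (intro continuous_on_add) auto
    then obtain t where "0 \<le> t" "elapsed ?x i t + elapsed ?x j t = (1 - \<epsilon>) * real k"
      using IVT'[of "\<lambda>t. elapsed ?x i t + elapsed ?x j t" 0 "(1 - \<epsilon>) * real k" C] le C eps
      by (auto simp: completes_at_def)
    then show ?thesis by auto
  qed
  then obtain t where t: "\<And>k. k < m \<Longrightarrow> 0 \<le> t k"
    "\<And>k. k < m \<Longrightarrow> elapsed ?x i (t k) + elapsed ?x j (t k) = (1 - \<epsilon>) * real k" by metis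
  define X where "X k = elapsed ?x i (t k) / (1 - \<epsilon>)" for k
  define Y where "Y k = elapsed ?x j (t k) / (1 - \<epsilon>)" for k
  have XY: "elapsed ?x i (t k) = (1 - \<epsilon>) * X k" "elapsed ?x j (t k) = (1 - \<epsilon>) * Y k" for k
    using eps by (simp_all add: X_def Y_def)
  show thesis
  proof (rule that[of X Y])
    fix k assume k: "k < m"
    show "0 \<le> X k" "0 \<le> Y k" using eps elapsed_nonneg[OF feas0 t(1)[OF k]] by (auto simp: X_def Y_def)
    show "X k + Y k = real k" using t(2)[OF k] eps by (simp add: XY flip: distrib_left)
  next
    fix a b k u v
    assume ab: "a \<in> {1..m}" "b \<in> {1..m}" and k: "k < m" and lt: "X k < real a" "Y k < real b"
      and uv: "completes_at (I a b) (A (I a b)) i u" "completes_at (I a b) (A (I a b)) j v"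
    let ?y = "A (I a b)"
    have sc: "(1 - \<epsilon>) * X k < (1 - \<epsilon>) * real a" "(1 - \<epsilon>) * Y k < (1 - \<epsilon>) * real b"
      using lt eps by auto
    have am: "(1 - \<epsilon>) * real a \<le> (1 - \<epsilon>) * real m" "(1 - \<epsilon>) * real b \<le> (1 - \<epsilon>) * real m"
      using ab eps by (auto intro!: mult_left_mono)
    \<comment> \<open>At \<open>t k\<close> both jobs are below their thresholds for the lengths a,
      b as well as for m, so the two runs coincide so far.\<close>
    have "elapsed ?x l (t k) = elapsed ?y l (t k)" for l
    proof (rule indistinguishable_runs[OF alg batch[OF mm mm] batch[OF ab] _ t(1)[OF k]])
      fix l assume "l \<in> jobs (I m m)"
      consider "l \<noteq> i" "l \<noteq> j" | "l = i" | "l = j" by blast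
      then show "ptime (I m m) l = ptime (I a b) l \<or>
         elapsed ?x l (t k) < (1 - \<epsilon>) * ptime (I m m) l \<and> elapsed ?x l (t k) < (1 - \<epsilon>) * ptime (I a b) l"
        using sc am ij by cases (auto simp: pt XY)
    qed (simp add: I_def)
    then have y: "elapsed ?y i (t k) = (1 - \<epsilon>) * X k" "elapsed ?y j (t k) = (1 - \<epsilon>) * Y k"
      using XY[of k] by auto
    have full: "elapsed ?y i u = real a" "elapsed ?y j v = real b" "0 \<le> u" "0 \<le> v"
      using uv ij by (auto simp: completes_at_def I_def)
    have le1: "(1 - \<epsilon>) * real a \<le> real a" "(1 - \<epsilon>) * real b \<le> real b"
      using eps by (auto simp: algebra_simps)
    have later: "t k \<le> u" "t k \<le> v"
      using elapsed_mono[OF feas[OF ab], of u "t k" i] elapsed_mono[OF feas[OF ab], of v "t k" j] y full sc le1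
      by linarith+
    have split: "(1 - \<epsilon>) * real k = (1 - \<epsilon>) * X k + (1 - \<epsilon>) * Y k" using t(2)[OF k] XY[of k] by simp
    have "(1 - \<epsilon>) * real k + \<epsilon> * real (min a b) \<le> elapsed ?y i (min u v) + elapsed ?y j (min u v)"
    proof (cases "u \<le> v")
      case True
      have "(1 - \<epsilon>) * Y k \<le> elapsed ?y j u" using elapsed_mono[OF feas[OF ab] t(1)[OF k] later(1), of j] y by simp
      moreover have "\<epsilon> * real (min a b) \<le> \<epsilon> * real a" using eps by (intro mult_left_mono) auto
      moreover have "(1 - \<epsilon>) * real a + \<epsilon> * real a = elapsed ?y i u" using full by (simp add: algebra_simps)
      ultimately show ?thesis using True sc split by (simp add: min_def)
    next
      case False
      have "(1 - \<epsilon>) * X k \<le> elapsed ?y i v" using elapsed_mono[OF feas[OF ab] t(1)[OF k] later(2), of i] y by simp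
      moreover have "\<epsilon> * real (min a b) \<le> \<epsilon> * real b" using eps by (intro mult_left_mono) auto
      moreover have "(1 - \<epsilon>) * real b + \<epsilon> * real b = elapsed ?y j v" using full by (simp add: algebra_simps)
      ultimately show ?thesis using False sc split by (simp add: min_def)
    qed
    also have "\<dots> \<le> elapsed ?y i v + elapsed ?y j u"
      by (rule pairwise_ge_at_first_completion[OF feas[OF ab] uv])
    finally show "(1 - \<epsilon>) * real k + \<epsilon> * real (min a b) \<le> elapsed ?y i v + elapsed ?y j u" .
  qed
qed

text \<open>The law of \<open>min G m\<close> with \<open>G\<close> geometric: \<open>P (a > l) = r ^ l\<close> for \<open>l < m\<close>.\<close>

definition geom_weight :: "real \<Rightarrow> nat \<Rightarrow> nat \<Rightarrow> real" where
  "geom_weight r m a = r ^ (a - 1) - (if a < m then r ^ a else 0)"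

lemma geom_weight_pos:
  assumes "0 < r" "r < 1" "a \<in> {1..m}"
  shows "0 < geom_weight r m a"
proof -
  have "r ^ a < r ^ (a - 1)" using assms by (intro power_strict_decreasing) auto
  then show ?thesis using assms by (auto simp: geom_weight_def)
qed

lemma geom_weight_tail: "l < m \<Longrightarrow> (\<Sum>a\<in>{l<..m}. geom_weight r m a) = r ^ l"
proof -
  assume l: "l < m"
  \<comment> \<open>Truncation sets G m = 0, which puts all remaining mass on m and closes the
    telescoping sum.\<close>
  define G where "G a = (if a < m then r ^ a else 0)" for a
  have "(\<Sum>a\<in>{l<..m}. geom_weight r m a) = (\<Sum>a\<in>{Suc l..m}. G (a - 1) - G a)"
    by (intro sum.cong) (auto simp: geom_weight_def G_def)
  also have "\<dots> = (\<Sum>a\<in>{Suc l..m}. - G a - (- G (a - 1)))" by simp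
  also have "\<dots> = - G m - (- G l)"
    using l by (subst sum_telescope'') auto
  also have "\<dots> = r ^ l" using l by (simp add: G_def)
  finally show ?thesis .
qed

lemma geom_weight_sum: "1 \<le> m \<Longrightarrow> (\<Sum>a\<in>{1..m}. geom_weight r m a) = 1"
  using geom_weight_tail[of 0 m r] by (simp add: atLeastSucAtMost_greaterThanAtMost)

text \<open>The tail beyond a real z is the tail beyond its floor l, of mass r^l, and r^l is at
  least r^z as r < 1. Real arguments are needed because the algorithm may split the processing of a
  pair arbitrarily.\<close>

lemma geom_weight_tail_ge:
  assumes "0 < r" "r < 1" "0 \<le> z" "z < real m"
  shows "r powr z \<le> (\<Sum>a\<in>{1..m}. if z < real a then geom_weight r m a else 0)"
proof -
  define l where "l = nat \<lfloor>z\<rfloor>"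
  have l: "real l \<le> z" "z < real l + 1" "l < m"
    using assms by (auto simp: l_def)  linarith+
  have "r powr z \<le> r powr real l" using assms l by (intro powr_mono') auto
  also have "\<dots> = (\<Sum>a\<in>{l<..m}. geom_weight r m a)" using geom_weight_tail l assms by (simp add: powr_realpow)
  also have "\<dots> = (\<Sum>a\<in>{1..m}. if z < real a then geom_weight r m a else 0)"
    using l by (intro sum.mono_neutral_cong_left) auto
  finally show ?thesis .
qed

text \<open>The expected minimum of two independent truncated geometric lengths.\<close>

definition geom_min :: "real \<Rightarrow> nat \<Rightarrow> real" where
  "geom_min r m = (\<Sum>a\<in>{1..m}. \<Sum>b\<in>{1..m}. geom_weight r m a * (geom_weight r m b * real (min a b)))"

text \<open>The minimum of a and b counts the l below both. By independence each l < m contributes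
  the square of the tail r^l.\<close>

lemma geom_min_eq: "geom_min r m = (\<Sum>l<m. r ^ (2 * l))"
proof -
  let ?w = "geom_weight r m"
  let ?s = "\<lambda>a l. if l < a then ?w a else 0"
  have "?w a * (?w b * real (min a b)) = (\<Sum>l<m. ?s a l * ?s b l)" if "a \<in> {1..m}" "b \<in> {1..m}" for a b
  proof -
    have "(\<Sum>l<m. ?s a l * ?s b l) = (\<Sum>l<min a b. ?w a * ?w b)"
      using that by (intro sum.mono_neutral_cong_right) auto
    then show ?thesis by simp
  qed
  then have "geom_min r m = (\<Sum>a\<in>{1..m}. \<Sum>b\<in>{1..m}. \<Sum>l<m. ?s a l * ?s b l)"
    unfolding geom_min_def by (intro sum.cong) auto
  also have "\<dots> = (\<Sum>a\<in>{1..m}. \<Sum>l<m. \<Sum>b\<in>{1..m}. ?s a l * ?s b l)"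
    by (intro sum.cong refl sum.swap)
  also have "\<dots> = (\<Sum>l<m. \<Sum>a\<in>{1..m}. \<Sum>b\<in>{1..m}. ?s a l * ?s b l)"
    by (rule sum.swap)
  also have "\<dots> = (\<Sum>l<m. (\<Sum>a\<in>{1..m}. ?s a l) * (\<Sum>b\<in>{1..m}. ?s b l))"
    by (simp add: sum_product)
  also have "\<dots> = (\<Sum>l<m. r ^ (2 * l))"
  proof (rule sum.cong[OF refl])
    fix l assume "l \<in> {..<m}"
    moreover have "(\<Sum>a\<in>{1..m}. ?s a l) = (\<Sum>a\<in>{l<..m}. ?w a)"
      by (intro sum.mono_neutral_cong_right) auto
    ultimately show "(\<Sum>a\<in>{1..m}. ?s a l) * (\<Sum>b\<in>{1..m}. ?s b l) = r ^ (2 * l)"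
      using geom_weight_tail[of l m r] by (simp add: mult_2 power_add)
  qed
  finally show ?thesis .
qed

text \<open>Under the product law the coordinate i is independent of the rest, so drawing it afresh
  leaves the expectation unchanged.\<close>

lemma sum_PiE_resample:
  fixes w :: "'b \<Rightarrow> real"
  assumes "finite J" "i \<in> J" "finite D" "(\<Sum>a\<in>D. w a) = 1"
  shows "(\<Sum>c\<in>PiE J (\<lambda>_. D). (\<Prod>l\<in>J. w (c l)) * f c) =
    (\<Sum>c\<in>PiE J (\<lambda>_. D). (\<Prod>l\<in>J. w (c l)) * (\<Sum>a\<in>D. w a * f (c(i := a))))"
proof -
  define K where "K = J - {i}"
  have J: "J = insert i K" "i \<notin> K" "finite K" using assms by (auto simp: K_def)
  have split: "(\<Sum>c\<in>PiE J (\<lambda>_. D). (\<Prod>l\<in>J. w (c l)) * g c) =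
      (\<Sum>a\<in>D. \<Sum>c\<in>PiE K (\<lambda>_. D). (\<Prod>l\<in>K. w (c l)) * (w a * g (c(i := a))))" for g
  proof -
    have "(\<Sum>c\<in>PiE J (\<lambda>_. D). (\<Prod>l\<in>J. w (c l)) * g c) =
        (\<Sum>(a, c)\<in>D \<times> PiE K (\<lambda>_. D). (\<Prod>l\<in>J. w ((c(i := a)) l)) * g (c(i := a)))"
      unfolding J(1) PiE_insert_eq
      by (subst sum.reindex) (use inj_combinator[OF J(2), of "\<lambda>_. D"] in \<open>auto simp: case_prod_unfold\<close>)
    also have "\<dots> = (\<Sum>(a, c)\<in>D \<times> PiE K (\<lambda>_. D). (\<Prod>l\<in>K. w (c l)) * (w a * g (c(i := a))))"
    proof (intro sum.cong refl, clarify)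
      fix a c
      have "(\<Prod>l\<in>K. w ((c(i := a)) l)) = (\<Prod>l\<in>K. w (c l))" using J by (intro prod.cong) auto
      then show "(\<Prod>l\<in>J. w ((c(i := a)) l)) * g (c(i := a)) = (\<Prod>l\<in>K. w (c l)) * (w a * g (c(i := a)))"
        unfolding J(1) using J(2,3) by simp
    qed
    finally show ?thesis by (simp add: sum.cartesian_product)
  qed
  have "(\<Sum>c\<in>PiE J (\<lambda>_. D). (\<Prod>l\<in>J. w (c l)) * (\<Sum>a\<in>D. w a * f (c(i := a)))) =
     (\<Sum>b\<in>D. w b * (\<Sum>c\<in>PiE K (\<lambda>_. D). (\<Prod>l\<in>K. w (c l)) * (\<Sum>a\<in>D. w a * f (c(i := a)))))"
    unfolding split by (simp add: sum_distrib_left mult_ac)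
  also have "\<dots> = (\<Sum>c\<in>PiE K (\<lambda>_. D). (\<Prod>l\<in>K. w (c l)) * (\<Sum>a\<in>D. w a * f (c(i := a))))"
    using assms(4) by (simp flip: sum_distrib_right)
  also have "\<dots> = (\<Sum>a\<in>D. \<Sum>c\<in>PiE K (\<lambda>_. D). (\<Prod>l\<in>K. w (c l)) * (w a * f (c(i := a))))"
    unfolding sum_distrib_left by (rule sum.swap)
  also have "\<dots> = (\<Sum>c\<in>PiE J (\<lambda>_. D). (\<Prod>l\<in>J. w (c l)) * f c)" by (rule split[symmetric])
  finally show ?thesis ..
qed

text \<open>All other lengths are fixed. Each k with X k < a and Y k < b gives a bound on d, and the
  largest such k is at least their number, so d dominates \<epsilon> min a b plus 1 - \<epsilon>
  times that number. By independence k is counted with probability at least r^(X k) * r^(Y k) =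
  r^k.\<close>

lemma pair_delay_expectation:
  fixes A :: algorithm
  defines "I \<equiv> grid_instance"
  assumes eps: "0 \<le> \<epsilon>" "\<epsilon> \<le> 1" and alg: "eps_clairvoyant batch_instances \<epsilon> A"
    and r: "0 < r" "r < 1" and m: "1 \<le> m" and c: "c \<in> grid n m" and ij: "i < n" "j < n" "i \<noteq> j"
    and finite: "\<And>c. c \<in> grid n m \<Longrightarrow> total_flow (I n c) (A (I n c)) \<noteq> \<infinity>"
    and C: "\<And>c l. c \<in> grid n m \<Longrightarrow> l < n \<Longrightarrow> completes_at (I n c) (A (I n c)) l (C c l)"
  defines "d \<equiv> \<lambda>c. elapsed (A (I n c)) i (C c j) + elapsed (A (I n c)) j (C c i)"
  shows "\<epsilon> * geom_min r m + (1 - \<epsilon>) * (\<Sum>k\<in>{1..<m}. r ^ k) \<le>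
    (\<Sum>a\<in>{1..m}. geom_weight r m a * (\<Sum>b\<in>{1..m}. geom_weight r m b * d (c(i := a, j := b))))"
proof -
  let ?w = "geom_weight r m"
  have upd: "c(i := a, j := b) \<in> grid n m" if "a \<in> {1..m}" "b \<in> {1..m}" for a b
    using c ij that by (intro grid_update)
  have ge_min: "real (min a b) \<le> d (c(i := a, j := b))" if "a \<in> {1..m}" "b \<in> {1..m}" for a b
    using pairwise_ge_min[OF _ C[OF upd[OF that] ij(1)] C[OF upd[OF that] ij(2)]] alg
      grid_instance_batch[OF upd[OF that]] ij(3)
    by (auto simp: eps_clairvoyant_def d_def I_def of_nat_min)
  obtain X Y :: "nat \<Rightarrow> real" where XY: "\<And>k. k < m \<Longrightarrow> 0 \<le> X k" "\<And>k. k < m \<Longrightarrow> 0 \<le> Y k"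
      "\<And>k. k < m \<Longrightarrow> X k + Y k = real k"
    and blind: "\<And>a b k. a \<in> {1..m} \<Longrightarrow> b \<in> {1..m} \<Longrightarrow> k < m \<Longrightarrow> X k < real a \<Longrightarrow> Y k < real b \<Longrightarrow>
       (1 - \<epsilon>) * real k + \<epsilon> * real (min a b) \<le> d (c(i := a, j := b))"
  proof (cases "\<epsilon> = 1")
    case True
    \<comment> \<open>For \<epsilon> = 1 the coefficient 1 - \<epsilon> vanishes, and any split of k
      serves.\<close>
    then show thesis using ge_min by (intro that[of "\<lambda>k. real k" "\<lambda>_. 0"]) auto
  next
    case False
    then have "\<epsilon> < 1" using eps by simp
    have mm: "m \<in> {1..m}" using m by simp
    show thesis
    proof (rule pair_blind_points[OF eps(1) \<open>\<epsilon> < 1\<close> alg c ij m finite[OF upd[OF mm mm], unfolded I_def]])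
      fix X Y :: "nat \<Rightarrow> real"
      assume XY: "\<And>k. k < m \<Longrightarrow> 0 \<le> X k" "\<And>k. k < m \<Longrightarrow> 0 \<le> Y k" "\<And>k. k < m \<Longrightarrow> X k + Y k = real k"
        and blind: "\<And>a b k s t. a \<in> {1..m} \<Longrightarrow> b \<in> {1..m} \<Longrightarrow> k < m \<Longrightarrow> X k < real a \<Longrightarrow> Y k < real b \<Longrightarrow>
          completes_at (grid_instance n (c(i := a, j := b))) (A (grid_instance n (c(i := a, j := b)))) i s \<Longrightarrow>
          completes_at (grid_instance n (c(i := a, j := b))) (A (grid_instance n (c(i := a, j := b)))) j t \<Longrightarrow>
          (1 - \<epsilon>) * real k + \<epsilon> * real (min a b) \<le> elapsed (A (grid_instance n (c(i := a, j := b)))) i t +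
            elapsed (A (grid_instance n (c(i := a, j := b)))) j s"
      show thesis
      proof (rule that[OF XY])
        fix a b k assume *: "a \<in> {1..m}" "b \<in> {1..m}" "k < m" "X k < real a" "Y k < real b"
        show "(1 - \<epsilon>) * real k + \<epsilon> * real (min a b) \<le> d (c(i := a, j := b))"
          unfolding d_def I_def using blind[OF *] C[OF upd[OF *(1,2)], unfolded I_def] ij by blast
      qed
    qed
  qed
  let ?ind = "\<lambda>z a. if z < real a then 1 else (0::real)"
  have d_ge: "\<epsilon> * real (min a b) + (1 - \<epsilon>) * (\<Sum>k\<in>{1..<m}. ?ind (X k) a * ?ind (Y k) b) \<le> d (c(i := a, j := b))"
    if ab: "a \<in> {1..m}" "b \<in> {1..m}" for a b
  proof -
    define Q where "Q = {k\<in>{1..<m}. X k < real a \<and> Y k < real b}"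
    have sumQ: "(\<Sum>k\<in>{1..<m}. ?ind (X k) a * ?ind (Y k) b) = real (card Q)"
    proof -
      have "(\<Sum>k\<in>{1..<m}. ?ind (X k) a * ?ind (Y k) b) = (\<Sum>k\<in>Q. 1)"
        by (intro sum.mono_neutral_cong_right) (auto simp: Q_def)
      then show ?thesis by simp
    qed
    show ?thesis
    proof (cases "Q = {}")
      case True
      have "\<epsilon> * real (min a b) \<le> real (min a b)" using eps by (intro mult_left_le_one_le) auto
      then show ?thesis using ge_min[OF ab] unfolding sumQ True by simp
    next
      case False
      have finQ: "finite Q" by (auto simp: Q_def)
      define k where "k = Max Q"
      have k: "k \<in> Q" unfolding k_def using finQ False by (rule Max_in)
      \<comment> \<open>The count starts at 1, so there are at most k indices up to the maximum
        k.\<close>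
      have "Q \<subseteq> {1..k}" using finQ by (auto simp: k_def) (auto simp: Q_def)
      then have "card Q \<le> k" using card_mono[of "{1..k}" Q] by simp
      then have "(1 - \<epsilon>) * real (card Q) \<le> (1 - \<epsilon>) * real k" using eps by (intro mult_left_mono) auto
      then show ?thesis using blind[OF ab, of k] k unfolding sumQ by (auto simp: Q_def)
    qed
  qed
  have w0: "0 \<le> ?w a" if "a \<in> {1..m}" for a using geom_weight_pos[OF r that] by simp
  have tail: "r powr z \<le> (\<Sum>a\<in>{1..m}. ?w a * ?ind z a)" if "0 \<le> z" "z < real m" for z
  proof -
    have "(\<Sum>a\<in>{1..m}. ?w a * ?ind z a) = (\<Sum>a\<in>{1..m}. if z < real a then ?w a else 0)"
      by (intro sum.cong) auto
    then show ?thesis using geom_weight_tail_ge[OF r that] by simp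
  qed
  have prod: "r ^ k \<le> (\<Sum>a\<in>{1..m}. ?w a * ?ind (X k) a) * (\<Sum>b\<in>{1..m}. ?w b * ?ind (Y k) b)" if "k \<in> {1..<m}" for k
  proof -
    have k: "k < m" using that by simp
    have lt: "X k < real m" "Y k < real m" using XY[OF k] k by linarith+
    have "r ^ k = r powr X k * r powr Y k" using XY(3)[OF k] r by (simp add: powr_realpow flip: powr_add)
    also have "\<dots> \<le> (\<Sum>a\<in>{1..m}. ?w a * ?ind (X k) a) * (\<Sum>b\<in>{1..m}. ?w b * ?ind (Y k) b)"
      using XY[OF k] lt w0 by (intro mult_mono tail sum_nonneg) auto
    finally show ?thesis .
  qed
  have "\<epsilon> * geom_min r m + (1 - \<epsilon>) * (\<Sum>k\<in>{1..<m}. r ^ k) \<le> \<epsilon> * geom_min r m +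
      (1 - \<epsilon>) * (\<Sum>k\<in>{1..<m}. (\<Sum>a\<in>{1..m}. ?w a * ?ind (X k) a) * (\<Sum>b\<in>{1..m}. ?w b * ?ind (Y k) b))"
    using eps prod by (intro add_left_mono mult_left_mono sum_mono) auto
  also have "(\<Sum>k\<in>{1..<m}. (\<Sum>a\<in>{1..m}. ?w a * ?ind (X k) a) * (\<Sum>b\<in>{1..m}. ?w b * ?ind (Y k) b)) =
      (\<Sum>k\<in>{1..<m}. \<Sum>a\<in>{1..m}. \<Sum>b\<in>{1..m}. ?w a * (?w b * (?ind (X k) a * ?ind (Y k) b)))"
    unfolding sum_product by (intro sum.cong refl) (simp only: mult_ac)
  also have "\<dots> = (\<Sum>a\<in>{1..m}. \<Sum>k\<in>{1..<m}. \<Sum>b\<in>{1..m}. ?w a * (?w b * (?ind (X k) a * ?ind (Y k) b)))"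
    by (rule sum.swap)
  also have "\<dots> = (\<Sum>a\<in>{1..m}. \<Sum>b\<in>{1..m}. \<Sum>k\<in>{1..<m}. ?w a * (?w b * (?ind (X k) a * ?ind (Y k) b)))"
    by (intro sum.cong refl sum.swap)
  also have "\<epsilon> * geom_min r m + (1 - \<epsilon>) * \<dots> = (\<Sum>a\<in>{1..m}. ?w a * (\<Sum>b\<in>{1..m}. ?w b *
      (\<epsilon> * real (min a b) + (1 - \<epsilon>) * (\<Sum>k\<in>{1..<m}. ?ind (X k) a * ?ind (Y k) b))))"
    unfolding geom_min_def sum_distrib_left distrib_left sum.distrib by (simp only: mult.left_commute)
  also have "\<dots> \<le> (\<Sum>a\<in>{1..m}. ?w a * (\<Sum>b\<in>{1..m}. ?w b * d (c(i := a, j := b))))"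
    by (intro sum_mono mult_left_mono d_ge w0)
  finally show ?thesis .
qed

section \<open>Expected cost of the algorithm and of the optimum\<close>

abbreviation grid_weight :: "real \<Rightarrow> nat \<Rightarrow> nat \<Rightarrow> (nat \<Rightarrow> nat) \<Rightarrow> real" where
  "grid_weight r n m c \<equiv> \<Prod>l<n. geom_weight r m (c l)"

lemma grid_weight_pos: "0 < r \<Longrightarrow> r < 1 \<Longrightarrow> c \<in> grid n m \<Longrightarrow> 0 < grid_weight r n m c"
  by (intro prod_pos geom_weight_pos) (auto simp: PiE_def Pi_def)

lemma grid_weight_sum: "1 \<le> m \<Longrightarrow> (\<Sum>c\<in>grid n m. grid_weight r n m c) = 1"
  using geom_weight_sum[of m r] by (subst prod_sum_PiE[symmetric]) auto

lemma grid_resample_pair: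
  assumes "1 \<le> m" "i < n" "j < n"
  shows "(\<Sum>c\<in>grid n m. grid_weight r n m c * f c) = (\<Sum>c\<in>grid n m. grid_weight r n m c *
     (\<Sum>a\<in>{1..m}. geom_weight r m a * (\<Sum>b\<in>{1..m}. geom_weight r m b * f (c(i := a, j := b)))))"
proof -
  have "(\<Sum>c\<in>grid n m. grid_weight r n m c * f c) =
      (\<Sum>c\<in>grid n m. grid_weight r n m c * (\<Sum>b\<in>{1..m}. geom_weight r m b * f (c(j := b))))"
    using assms geom_weight_sum by (intro sum_PiE_resample) auto
  also have "\<dots> = (\<Sum>c\<in>grid n m. grid_weight r n m c *
     (\<Sum>a\<in>{1..m}. geom_weight r m a * (\<Sum>b\<in>{1..m}. geom_weight r m b * f (c(i := a, j := b)))))"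
    using assms geom_weight_sum by (intro sum_PiE_resample) auto
  finally show ?thesis .
qed

lemma sum_off_diagonal:
  "(\<Sum>i<n. \<Sum>j<n. if i = j then 0 else z) = real n * (real n - 1) * (z::real)"
proof -
  have "(\<Sum>j<n. if i = j then 0 else z) = (real n - 1) * z" if "i < n" for i
  proof -
    have "(\<Sum>j<n. if i = j then 0 else z) = (\<Sum>j\<in>{..<n} - {i}. z)"
      by (intro sum.mono_neutral_cong_right) auto
    then show ?thesis using that by (simp add: of_nat_diff)
  qed
  then show ?thesis by (simp add: mult.assoc)
qed

text \<open>An instance of infinite flow has positive weight and makes the right-hand side infinite.
  Otherwise the n (n - 1) ordered pairs are bounded one by one after resampling both lengths, and
  the nonnegative diagonal terms are dropped.\<close>

lemma expected_flow_ge: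
  assumes eps: "0 \<le> \<epsilon>" "\<epsilon> \<le> 1" and alg: "eps_clairvoyant batch_instances \<epsilon> A"
    and r: "0 < r" "r < 1" and m: "1 \<le> m"
  shows "ennreal (real n * (real n - 1) / 2 * (\<epsilon> * geom_min r m + (1 - \<epsilon>) * (\<Sum>k\<in>{1..<m}. r ^ k))) \<le>
    (\<Sum>c\<in>grid n m. ennreal (grid_weight r n m c) * total_flow (grid_instance n c) (A (grid_instance n c)))"
proof -
  let ?I = "grid_instance n" and ?W = "grid_weight r n m"
  let ?z = "\<epsilon> * geom_min r m + (1 - \<epsilon>) * (\<Sum>k\<in>{1..<m}. r ^ k)"
  have finG: "finite (grid n m)" by (intro finite_PiE) auto
  have W: "0 < ?W c" if "c \<in> grid n m" for c using grid_weight_pos[OF r that] .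
  have feas: "feasible (?I c) (A (?I c))" if "c \<in> grid n m" for c
    using alg grid_instance_batch[OF that] by (auto simp: eps_clairvoyant_def)
  show ?thesis
  proof (cases "\<exists>c\<in>grid n m. total_flow (?I c) (A (?I c)) = \<infinity>")
    case True
    then obtain c where c: "c \<in> grid n m" "total_flow (?I c) (A (?I c)) = \<infinity>" by auto
    then have "ennreal (?W c) * total_flow (?I c) (A (?I c)) = \<infinity>"
      using W[OF c(1)] unfolding infinity_ennreal_def ennreal_mult_eq_top_iff
      by (metis ennreal_eq_0_iff infinity_ennreal_def not_le)
    then have "(\<Sum>c\<in>grid n m. ennreal (?W c) * total_flow (?I c) (A (?I c))) = \<infinity>"
      using member_le_sum[of c "grid n m" "\<lambda>c. ennreal (?W c) * total_flow (?I c) (A (?I c))"] c(1) finG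
      by (simp add: top_unique)
    then show ?thesis by simp
  next
    case False
    then have flows: "total_flow (?I c) (A (?I c)) \<noteq> \<infinity>" if "c \<in> grid n m" for c using that by auto
    have "\<exists>C. (\<forall>l<n. completes_at (?I c) (A (?I c)) l (C l)) \<and> total_flow (?I c) (A (?I c)) = ennreal (\<Sum>l<n. C l)"
      if "c \<in> grid n m" for c
      using total_flow_finiteE[OF grid_instance_batch[OF that] feas[OF that] flows[OF that]] by simp metis
    then obtain C where C: "\<And>c l. c \<in> grid n m \<Longrightarrow> l < n \<Longrightarrow> completes_at (?I c) (A (?I c)) l (C c l)"
      and flow: "\<And>c. c \<in> grid n m \<Longrightarrow> total_flow (?I c) (A (?I c)) = ennreal (\<Sum>l<n. C c l)" by metis
    define d where "d i j c = elapsed (A (?I c)) i (C c j) + elapsed (A (?I c)) j (C c i)" for i j c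
    have d0: "0 \<le> d i j c" if "c \<in> grid n m" "i < n" "j < n" for i j c
      unfolding d_def using C[OF that(1,2)] C[OF that(1,3)]
      by (intro add_nonneg_nonneg elapsed_nonneg[OF feas[OF that(1)]]) (auto simp: completes_at_def)
    have pair: "?z \<le> (\<Sum>c\<in>grid n m. ?W c * d i j c)" if ij: "i < n" "j < n" "i \<noteq> j" for i j
    proof -
      have "?z = (\<Sum>c\<in>grid n m. ?W c * ?z)" using grid_weight_sum[OF m] by (simp flip: sum_distrib_right)
      also have "\<dots> \<le> (\<Sum>c\<in>grid n m. ?W c *
          (\<Sum>a\<in>{1..m}. geom_weight r m a * (\<Sum>b\<in>{1..m}. geom_weight r m b * d i j (c(i := a, j := b)))))"
        unfolding d_def
        by (intro sum_mono mult_left_mono pair_delay_expectation[OF eps alg r m] flows C ij) (use W in \<open>auto simp: less_imp_le\<close>)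
      also have "\<dots> = (\<Sum>c\<in>grid n m. ?W c * d i j c)" by (rule grid_resample_pair[OF m ij(1,2), symmetric])
      finally show ?thesis .
    qed
    have "real n * (real n - 1) * ?z = (\<Sum>i<n. \<Sum>j<n. if i = j then 0 else ?z)" by (simp only: sum_off_diagonal)
    also have "\<dots> \<le> (\<Sum>i<n. \<Sum>j<n. \<Sum>c\<in>grid n m. ?W c * d i j c)"
    proof (intro sum_mono)
      fix i j assume ij: "i \<in> {..<n}" "j \<in> {..<n}"
      have "0 \<le> (\<Sum>c\<in>grid n m. ?W c * d i j c)"
        using ij W d0 by (intro sum_nonneg mult_nonneg_nonneg) (auto simp: less_imp_le)
      then show "(if i = j then 0 else ?z) \<le> (\<Sum>c\<in>grid n m. ?W c * d i j c)" using pair[of i j] ij by auto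
    qed
    also have "\<dots> = (\<Sum>i<n. \<Sum>c\<in>grid n m. \<Sum>j<n. ?W c * d i j c)" by (intro sum.cong refl sum.swap)
    also have "\<dots> = (\<Sum>c\<in>grid n m. \<Sum>i<n. \<Sum>j<n. ?W c * d i j c)" by (rule sum.swap)
    also have "\<dots> = (\<Sum>c\<in>grid n m. ?W c * (\<Sum>i<n. \<Sum>j<n. d i j c))" by (simp only: sum_distrib_left)
    also have "\<dots> \<le> (\<Sum>c\<in>grid n m. ?W c * (2 * (\<Sum>l<n. C c l)))"
    proof (intro sum_mono mult_left_mono)
      fix c assume c: "c \<in> grid n m"
      show "(\<Sum>i<n. \<Sum>j<n. d i j c) \<le> 2 * (\<Sum>l<n. C c l)"
        using pairwise_le_twice_completion[OF grid_instance_batch[OF c] feas[OF c], of "C c"] C[OF c] by (simp add: d_def)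
    qed (use W in \<open>auto simp: less_imp_le\<close>)
    also have "\<dots> = 2 * (\<Sum>c\<in>grid n m. ?W c * (\<Sum>l<n. C c l))"
      unfolding sum_distrib_left[of 2 _ "grid n m"] by (intro sum.cong refl mult.left_commute)
    finally have "ennreal (real n * (real n - 1) / 2 * ?z) \<le> ennreal (\<Sum>c\<in>grid n m. ?W c * (\<Sum>l<n. C c l))"
      by (intro ennreal_leI) simp
    also have "\<dots> = (\<Sum>c\<in>grid n m. ennreal (?W c * (\<Sum>l<n. C c l)))"
      using W C by (intro sum_ennreal[symmetric] mult_nonneg_nonneg sum_nonneg) (auto simp: less_imp_le completes_at_def)
    also have "\<dots> = (\<Sum>c\<in>grid n m. ennreal (?W c) * total_flow (?I c) (A (?I c)))"
      using W C by (intro sum.cong refl) (auto simp: flow less_imp_le completes_at_def intro!: ennreal_mult sum_nonneg)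
    finally show ?thesis .
  qed
qed

text \<open>The diagonal is bounded crudely by n m, which is linear in n and disappears against the
  quadratically many pairs.\<close>

lemma expected_opt_le:
  assumes r: "0 < r" "r < 1" and m: "1 \<le> m"
  shows "(\<Sum>c\<in>grid n m. grid_weight r n m c * pair_bound 1 (grid_instance n c)) \<le>
    real n * real m + real n * (real n - 1) / 2 * geom_min r m"
proof -
  let ?W = "grid_weight r n m"
  have Emin: "(\<Sum>c\<in>grid n m. ?W c * real (min (c i) (c j))) = geom_min r m" if ij: "i < n" "j < n" "i \<noteq> j" for i j
  proof -
    have "(\<Sum>a\<in>{1..m}. geom_weight r m a * (\<Sum>b\<in>{1..m}. geom_weight r m b *
        real (min ((c(i := a, j := b)) i) ((c(i := a, j := b)) j)))) = geom_min r m" for c :: "nat \<Rightarrow> nat"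
      using ij(3) by (simp add: geom_min_def sum_distrib_left)
    then have "(\<Sum>c\<in>grid n m. ?W c * real (min (c i) (c j))) = (\<Sum>c\<in>grid n m. ?W c * geom_min r m)"
      by (subst grid_resample_pair[OF m ij(1,2)]) simp
    also have "\<dots> = geom_min r m" using grid_weight_sum[OF m] by (simp flip: sum_distrib_right)
    finally show ?thesis .
  qed
  have "(\<Sum>c\<in>grid n m. ?W c * pair_bound 1 (grid_instance n c)) =
      (\<Sum>c\<in>grid n m. \<Sum>i<n. \<Sum>j<n. ?W c * (if i = j then real (c i) else 1 / 2 * real (min (c i) (c j))))"
    by (simp add: pair_bound_def sum_distrib_left of_nat_min cong: if_cong)
  also have "\<dots> = (\<Sum>i<n. \<Sum>c\<in>grid n m. \<Sum>j<n. ?W c * (if i = j then real (c i) else 1 / 2 * real (min (c i) (c j))))"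
    by (rule sum.swap)
  also have "\<dots> = (\<Sum>i<n. \<Sum>j<n. \<Sum>c\<in>grid n m. ?W c * (if i = j then real (c i) else 1 / 2 * real (min (c i) (c j))))"
    by (intro sum.cong refl sum.swap)
  also have "\<dots> \<le> (\<Sum>i<n. \<Sum>j<n. (if i = j then real m else 0) + (if i = j then 0 else 1 / 2 * geom_min r m))"
  proof (intro sum_mono)
    fix i j assume ij: "i \<in> {..<n}" "j \<in> {..<n}"
    show "(\<Sum>c\<in>grid n m. ?W c * (if i = j then real (c i) else 1 / 2 * real (min (c i) (c j)))) \<le>
        (if i = j then real m else 0) + (if i = j then 0 else 1 / 2 * geom_min r m)"
    proof (cases "i = j")
      case True
      have "(\<Sum>c\<in>grid n m. ?W c * real (c i)) \<le> (\<Sum>c\<in>grid n m. ?W c * real m)"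
        using ij grid_weight_pos[OF r] by (intro sum_mono mult_left_mono) (auto simp: PiE_def Pi_def less_imp_le)
      also have "\<dots> = real m" using grid_weight_sum[OF m] by (simp flip: sum_distrib_right)
      finally show ?thesis using True by simp
    next
      case False
      have "(\<Sum>c\<in>grid n m. ?W c * (1 / 2 * real (min (c i) (c j)))) = 1 / 2 * (\<Sum>c\<in>grid n m. ?W c * real (min (c i) (c j)))"
        unfolding sum_distrib_left by (intro sum.cong refl) (simp only: mult_ac)
      then show ?thesis using False Emin[of i j] ij by simp
    qed
  qed
  also have "\<dots> = real n * real m + real n * (real n - 1) / 2 * geom_min r m"
    unfolding sum.distrib sum_off_diagonal by simp
  finally show ?thesis .
qed

text \<open>Averaging as in Yao's principle: the deterministic bound holds for every seed, and the
  finite sum over instances is exchanged with the integral over seeds.\<close>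

lemma randomized_ratio_grid:
  assumes eps: "0 \<le> \<epsilon>" "\<epsilon> \<le> 1" and alg: "randomized_eps_clairvoyant batch_instances \<epsilon> M A"
    and comp: "randomized_competitive batch_instances \<rho> M A" and rho: "0 \<le> \<rho>"
    and r: "0 < r" "r < 1" and m: "1 \<le> m"
  shows "real n * (real n - 1) / 2 * (\<epsilon> * geom_min r m + (1 - \<epsilon>) * (\<Sum>k\<in>{1..<m}. r ^ k)) \<le>
    \<rho> * (real n * real m + real n * (real n - 1) / 2 * geom_min r m)" (is "?L \<le> \<rho> * ?R")
proof -
  interpret prob_space M using alg by (simp add: randomized_eps_clairvoyant_def)
  let ?I = "grid_instance n" and ?W = "grid_weight r n m"
  have batch: "?I c \<in> batch_instances" if "c \<in> grid n m" for c by (rule grid_instance_batch[OF that])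
  have meas: "(\<lambda>\<omega>. total_flow (?I c) (A \<omega> (?I c))) \<in> borel_measurable M" if "c \<in> grid n m" for c
    using alg batch[OF that] by (simp add: randomized_eps_clairvoyant_def)
  have W: "0 \<le> ?W c" if "c \<in> grid n m" for c using grid_weight_pos[OF r that] by simp
  have "ennreal ?L = (\<integral>\<^sup>+\<omega>. ennreal ?L \<partial>M)" by (simp add: emeasure_space_1)
  also have "\<dots> \<le> (\<integral>\<^sup>+\<omega>. (\<Sum>c\<in>grid n m. ennreal (?W c) * total_flow (?I c) (A \<omega> (?I c))) \<partial>M)"
    using alg by (intro nn_integral_mono expected_flow_ge eps r m) (simp add: randomized_eps_clairvoyant_def)
  also have "\<dots> = (\<Sum>c\<in>grid n m. \<integral>\<^sup>+\<omega>. ennreal (?W c) * total_flow (?I c) (A \<omega> (?I c)) \<partial>M)"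
    by (intro nn_integral_sum borel_measurable_times_ennreal borel_measurable_const meas)
  also have "\<dots> = (\<Sum>c\<in>grid n m. ennreal (?W c) * (\<integral>\<^sup>+\<omega>. total_flow (?I c) (A \<omega> (?I c)) \<partial>M))"
    by (intro sum.cong refl nn_integral_cmult meas)
  also have "\<dots> \<le> (\<Sum>c\<in>grid n m. ennreal (?W c) * (ennreal \<rho> * ennreal (pair_bound 1 (?I c))))"
  proof (intro sum_mono mult_left_mono)
    fix c assume c: "c \<in> grid n m"
    have "(\<integral>\<^sup>+\<omega>. total_flow (?I c) (A \<omega> (?I c)) \<partial>M) \<le> ennreal \<rho> * opt_flow (?I c)"
      using comp batch[OF c] by (simp add: randomized_competitive_def)
    also have "\<dots> \<le> ennreal \<rho> * ennreal (pair_bound 1 (?I c))"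
      by (intro mult_left_mono opt_flow_le batch[OF c]) simp
    finally show "(\<integral>\<^sup>+\<omega>. total_flow (?I c) (A \<omega> (?I c)) \<partial>M) \<le> ennreal \<rho> * ennreal (pair_bound 1 (?I c))" .
  qed simp
  also have "\<dots> = (\<Sum>c\<in>grid n m. ennreal (?W c * (\<rho> * pair_bound 1 (?I c))))"
    using W rho pair_bound_nonneg[OF batch, of _ 1] by (intro sum.cong refl) (simp add: ennreal_mult)
  also have "\<dots> = ennreal (\<Sum>c\<in>grid n m. ?W c * (\<rho> * pair_bound 1 (?I c)))"
    using W rho pair_bound_nonneg[OF batch, of _ 1] by (intro sum_ennreal) simp
  also have "(\<Sum>c\<in>grid n m. ?W c * (\<rho> * pair_bound 1 (?I c))) = \<rho> * (\<Sum>c\<in>grid n m. ?W c * pair_bound 1 (?I c))"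
    unfolding sum_distrib_left by (intro sum.cong refl) (simp only: mult_ac)
  also have "ennreal \<dots> \<le> ennreal (\<rho> * ?R)"
    by (intro ennreal_leI mult_left_mono expected_opt_le r m rho)
  finally have "ennreal ?L \<le> ennreal (\<rho> * ?R)" .
  \<comment> \<open>\<open>ennreal\<close> sends negative reals to 0, so the inequality returns to
    the reals only with a nonnegative right-hand side.\<close>
  moreover have "0 \<le> \<rho> * ?R"
  proof -
    have "0 \<le> real n * (real n - 1)" by (cases n) auto
    moreover have "0 \<le> geom_min r m" unfolding geom_min_eq using r by (intro sum_nonneg) auto
    ultimately show ?thesis using rho by simp
  qed
  ultimately show ?thesis by (simp add: ennreal_le_iff)
qed

text \<open>Three limits in turn: many jobs remove the diagonal, m to infinity removes the
  truncation, and r to 1 gives \<epsilon> + 2 (1 - \<epsilon>) = 2 - \<epsilon>.\<close>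

lemma randomized_lower_bound:
  assumes eps: "0 \<le> \<epsilon>" "\<epsilon> \<le> 1" and alg: "randomized_eps_clairvoyant batch_instances \<epsilon> M A"
    and comp: "randomized_competitive batch_instances \<rho> M A"
  shows "2 - \<epsilon> \<le> \<rho>"
proof -
  \<comment> \<open>A negative ratio acts as 0 inside \<open>ennreal\<close>, so \<sigma> is
    achieved whenever \<rho> is.\<close>
  define \<sigma> where "\<sigma> = max 0 \<rho>"
  have \<sigma>: "0 \<le> \<sigma>" by (simp add: \<sigma>_def)
  have comp': "randomized_competitive batch_instances \<sigma> M A"
    using comp by (auto simp: randomized_competitive_def \<sigma>_def max_def ennreal_neg)
  have many_jobs: "\<epsilon> * geom_min r m + (1 - \<epsilon>) * (\<Sum>k\<in>{1..<m}. r ^ k) \<le> \<sigma> * geom_min r m" (is "?z \<le> _")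
    if r: "0 < r" "r < 1" and m: "1 \<le> m" for r m
  proof (rule LIMSEQ_le_const)
    show "(\<lambda>k. \<sigma> * (2 * real m * inverse (real (Suc k)) + geom_min r m)) \<longlonglongrightarrow> \<sigma> * geom_min r m"
      by (rule tendsto_eq_intros LIMSEQ_inverse_real_of_nat refl)+ simp
    have "?z \<le> \<sigma> * (2 * real m * inverse (real (Suc k)) + geom_min r m)" for k
    proof -
      \<comment> \<open>With n = k + 2, division by the number n (n - 1) / 2 of pairs turns n m into
        2 m / (k + 1).\<close>
      define n where "n = Suc (Suc k)"
      have n: "real n - 1 = real (Suc k)" by (simp add: n_def)
      have pos: "0 < real n * (real n - 1) / 2" unfolding n by (simp add: n_def)
      have "\<sigma> * (real n * real m + real n * (real n - 1) / 2 * geom_min r m) =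
          real n * (real n - 1) / 2 * (\<sigma> * (2 * real m * inverse (real (Suc k)) + geom_min r m))"
        unfolding n by (simp add: field_simps del: of_nat_Suc)
      with randomized_ratio_grid[OF eps alg comp' \<sigma> r m, of n] pos show ?thesis
        by (metis mult_le_cancel_left_pos)
    qed
    then show "\<exists>N. \<forall>k\<ge>N. ?z \<le> \<sigma> * (2 * real m * inverse (real (Suc k)) + geom_min r m)" by blast
  qed
  have long_jobs: "\<epsilon> + (1 - \<epsilon>) * (r * (1 + r)) \<le> \<sigma>" if r: "0 < r" "r < 1" for r
  proof -
    have sq: "r ^ 2 < 1" "0 < 1 - r ^ 2" using r by (auto simp: power_less_one_iff)
    have "\<epsilon> * (1 - r ^ (2 * m)) + (1 - \<epsilon>) * ((1 + r) * (r - r ^ m)) \<le> \<sigma> * (1 - r ^ (2 * m))" if m: "1 \<le> m" for m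
    proof -
      \<comment> \<open>Multiplying by 1 - r^2 replaces both geometric sums by closed forms whose
        limits in m are immediate.\<close>
      have g1: "geom_min r m * (1 - r ^ 2) = 1 - r ^ (2 * m)"
        using sq by (simp add: geom_min_eq power_mult sum_gp_strict)
      have "(\<Sum>k\<in>{1..<m}. r ^ k) * (1 - r) = r - r ^ m"
        using m
      proof (induction m rule: dec_induct)
        case (step k)
        have "(\<Sum>i\<in>{1..<Suc k}. r ^ i) * (1 - r) = (\<Sum>i\<in>{1..<k}. r ^ i) * (1 - r) + r ^ k * (1 - r)"
          using step(1) by (simp add: distrib_right)
        then show ?case unfolding step.IH by (simp add: algebra_simps)
      qed simp
      moreover have "1 - r ^ 2 = (1 - r) * (1 + r)" by (simp add: power2_eq_square algebra_simps)
      ultimately have g2: "(\<Sum>k\<in>{1..<m}. r ^ k) * (1 - r ^ 2) = (1 + r) * (r - r ^ m)"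
        by (metis mult.assoc mult.commute)
      have "(\<epsilon> * geom_min r m + (1 - \<epsilon>) * (\<Sum>k\<in>{1..<m}. r ^ k)) * (1 - r ^ 2) \<le> \<sigma> * geom_min r m * (1 - r ^ 2)"
        using many_jobs[OF r m] sq by (intro mult_right_mono) auto
      then show ?thesis by (simp only: distrib_right mult.assoc g1 g2)
    qed
    moreover have "(\<lambda>m. \<epsilon> * (1 - r ^ (2 * m)) + (1 - \<epsilon>) * ((1 + r) * (r - r ^ m))) \<longlonglongrightarrow>
        \<epsilon> * (1 - 0) + (1 - \<epsilon>) * ((1 + r) * (r - 0))"
      using r sq unfolding power_mult by (intro tendsto_intros LIMSEQ_power_zero) auto
    moreover have "(\<lambda>m. \<sigma> * (1 - r ^ (2 * m))) \<longlonglongrightarrow> \<sigma> * (1 - 0)"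
      using r sq unfolding power_mult by (intro tendsto_intros LIMSEQ_power_zero) auto
    ultimately have "\<epsilon> * (1 - 0) + (1 - \<epsilon>) * ((1 + r) * (r - 0)) \<le> \<sigma> * (1 - 0)"
      using LIMSEQ_le by blast
    then show ?thesis by (simp add: mult.commute)
  qed
  have "\<epsilon> + (1 - \<epsilon>) * (1 * (1 + 1)) \<le> \<sigma>"
  proof (rule LIMSEQ_le_const2)
    let ?r = "\<lambda>k. 1 + - inverse (real (Suc k))"
    show "(\<lambda>k. \<epsilon> + (1 - \<epsilon>) * (?r k * (1 + ?r k))) \<longlonglongrightarrow> \<epsilon> + (1 - \<epsilon>) * (1 * (1 + 1))"
      by (intro tendsto_intros LIMSEQ_inverse_real_of_nat_add_minus)
    \<comment> \<open>The index k = 0 would give r = 0 and is skipped.\<close>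
    have "0 < ?r k" "?r k < 1" if "1 \<le> k" for k
      using that by (auto simp: field_simps)
    then show "\<exists>N. \<forall>k\<ge>N. \<epsilon> + (1 - \<epsilon>) * (?r k * (1 + ?r k)) \<le> \<sigma>"
      by (intro exI[of _ 1] allI impI long_jobs) auto
  qed
  \<comment> \<open>As 2 - \<epsilon> is positive, \<sigma> cannot be 0 and equals \<rho>.\<close>
  then show ?thesis using eps by (auto simp: \<sigma>_def max_def split: if_splits)
qed

theorem theorem1p2:
  fixes \<epsilon> :: real
  assumes "0 \<le> \<epsilon>" and "\<epsilon> \<le> 1"
  shows "((\<exists>A. eps_clairvoyant batch_instances \<epsilon> A \<and> is_SLF batch_instances \<epsilon> A) \<and>
          (\<forall>A. is_SLF batch_instances \<epsilon> A \<longrightarrow> competitive batch_instances (2 - \<epsilon>) A)) \<and>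
         (\<forall>(M :: 'w measure) A \<rho>.
            randomized_eps_clairvoyant batch_instances \<epsilon> M A \<longrightarrow>
            randomized_competitive batch_instances \<rho> M A \<longrightarrow> 2 - \<epsilon> \<le> \<rho>)"
  using SLF_exists[OF assms] SLF_competitive[OF assms] randomized_lower_bound[OF assms] by blast

end
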